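(* For all positive integers $s,t$ with $3\le s\le t-1$, $\mathrm{ex}\big(n,(K_{s+1,t}^+)^{\mathrm{sub}}\big)=O\!\left(n^{1+\frac{s^2+1}{2s+2s^2}}\right)$; that is, there is a constant $C=C(s,t)$ such that every $n$-vertex graph not containing $(K_{s+1,t}^+)^{\mathrm{sub}}$ as a subgraph has at most $C\,n^{1+\frac{s^2+1}{2s+2s^2}}$ edges.
   Context: $\mathrm{ex}(n,F)$ denotes the maximum number of edges of an $n$-vertex graph containing no (not necessarily induced) subgraph isomorphic to $F$. $K_{s+1,t}^+$ is the graph obtained from a copy of the complete bipartite graph $K_{s,t}$ (with parts of sizes $s$ and $t$) by adding one new vertex $r$ joined to exactly one vertex of the $s$-part and to all vertices of the $t$-part. For a graph $H$, $H^{\mathrm{sub}}$ denotes its $1$-subdivision, obtained by replacing each edge by a path of length two. *)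

theory Defs
  imports Complex_Main "HOL-Library.Landau_Symbols"
begin

record 'a graph =
  verts :: "'a set"
  edges :: "'a set set"

definition simple_graph :: "'a graph \<Rightarrow> bool" where
  "simple_graph G \<longleftrightarrow> finite (verts G) \<and> (\<forall>e\<in>edges G. e \<subseteq> verts G \<and> card e = 2)"

text \<open>Containment as a not necessarily induced subgraph, up to isomorphism.\<close>

definition contains_copy :: "'a graph \<Rightarrow> 'b graph \<Rightarrow> bool" where
  "contains_copy G F \<longleftrightarrow>
     (\<exists>f. inj_on f (verts F) \<and> f ` verts F \<subseteq> verts G \<and> (\<forall>e\<in>edges F. f ` e \<in> edges G))"

text \<open>Host graphs on \<^typ>\<open>nat\<close> suffice, since every finite graph is isomorphic to one of these.
  The set is finite, and it is nonempty as soon as \<open>F\<close> has an edge (see below).\<close>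

definition ex :: "nat \<Rightarrow> 'b graph \<Rightarrow> nat" where
  "ex n F = Max {card (edges G) | G :: nat graph.
     simple_graph G \<and> card (verts G) = n \<and> \<not> contains_copy G F}"

text \<open>The old vertices are tagged \<open>Inl\<close>; the middle vertex of the path replacing \<open>e\<close> is \<open>Inr e\<close>.\<close>

definition subdivision :: "'a graph \<Rightarrow> ('a + 'a set) graph" where
  "subdivision H =
     \<lparr>verts = Inl ` verts H \<union> Inr ` edges H,
      edges = {{Inl v, Inr e} | v e. e \<in> edges H \<and> v \<in> e}\<rparr>"

datatype kvertex = SV nat | TV nat | RV

text \<open>\<open>K_plus s t\<close> is $K_{s+1,t}^+$: the vertices \<open>SV i\<close>, \<open>TV j\<close> span $K_{s,t}$, and the new vertex
  \<open>RV\<close> is joined to \<open>SV 0\<close> and to all \<open>TV j\<close>. It is meaningful for \<open>s > 0\<close>.\<close>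

definition K_plus :: "nat \<Rightarrow> nat \<Rightarrow> kvertex graph" where
  "K_plus s t =
     \<lparr>verts = SV ` {..<s} \<union> TV ` {..<t} \<union> {RV},
      edges = {{SV i, TV j} | i j. i < s \<and> j < t} \<union> {{RV, SV 0}} \<union> {{RV, TV j} | j. j < t}\<rparr>"

lemma simple_graph_K_plus: "s > 0 \<Longrightarrow> simple_graph (K_plus s t)"
  by (auto simp: simple_graph_def K_plus_def)

lemma simple_graph_subdivision:
  assumes "simple_graph H"
  shows "simple_graph (subdivision H)"
proof -
  have "edges H \<subseteq> Pow (verts H)"
    using assms by (auto simp: simple_graph_def)
  then have "finite (edges H)"
    using assms finite_subset by (auto simp: simple_graph_def)
  then show ?thesis
    using assms by (auto simp: simple_graph_def subdivision_def)
qed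

lemma finite_ex_set:
  "finite {card (edges G) | G :: 'a graph.
     simple_graph G \<and> card (verts G) = n \<and> \<not> contains_copy G F}"
proof (rule finite_subset)
  show "{card (edges G) | G :: 'a graph.
     simple_graph G \<and> card (verts G) = n \<and> \<not> contains_copy G F} \<subseteq> {..2 ^ n}"
  proof clarsimp
    fix G :: "'a graph"
    assume "simple_graph G"
    then have "edges G \<subseteq> Pow (verts G)" "finite (verts G)"
      by (auto simp: simple_graph_def)
    then show "card (edges G) \<le> 2 ^ card (verts G)"
      by (metis card_Pow card_mono finite_Pow_iff)
  qed
qed simp

lemma ex_set_nonempty:
  assumes "edges F \<noteq> {}"
  shows "{card (edges G) | G :: nat graph.
     simple_graph G \<and> card (verts G) = n \<and> \<not> contains_copy G F} \<noteq> {}"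
proof -
  have "simple_graph \<lparr>verts = {..<n}, edges = {}\<rparr> \<and>
      card (verts \<lparr>verts = {..<n}, edges = {}\<rparr>) = n \<and>
      \<not> contains_copy \<lparr>verts = {..<n}, edges = {}\<rparr> F"
    using assms by (auto simp: simple_graph_def contains_copy_def)
  then show ?thesis
    by blast
qed

lemma edges_subdivision_K_plus: "edges (subdivision (K_plus s t)) \<noteq> {}"
  by (auto simp: subdivision_def K_plus_def)

end

theory Submission
  imports
    Defs
    "HOL-Library.Disjoint_Sets"
    "HOL-Library.Discrete_Functions"
    "HOL-Real_Asymp.Real_Asymp"
begin

text \<open>
  Pass to a bipartite subgraph between \<open>A\<close> and \<open>B\<close> in which all degrees in \<open>B\<close> agree up to a factor
  of two and all degrees in \<open>A\<close> are at least \<open>\<delta>\<close>. Call two vertices of \<open>A\<close> light if they have few, but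
  some, common neighbours. Since pairwise heavy vertices yield the subdivision greedily, the light
  graph has density at least about \<open>p = \<delta>\<^sup>2 / n\<close> on every subset of \<open>A\<close> that is not too small.

  Count pairs of common light neighbours \<open>v, w\<close> of tuples \<open>z\<^sub>0, \<dots>, z\<^sub>s\<close> with \<open>z\<^sub>0, z\<^sub>1\<close> light. Writing
  \<open>d(v, w)\<close> for the codegree in the light graph, there are at least about \<open>p \<Sum> d(v, w)\<^sup>s\<^sup>+\<^sup>1\<close> of them,
  by the density applied to the common neighbourhoods. If the subdivision is absent, then for every
  tuple most of the pairs with \<open>v \<noteq> w\<close> have clashing subdivision vertices; a clash confines one of
  \<open>z\<^sub>0, \<dots>, z\<^sub>s\<close> to a set of size \<open>O(\<Delta>)\<close>, where \<open>\<Delta>\<close> is the maximum degree in \<open>B\<close>, so there are only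
  \<open>O(\<Delta> \<Sum> d(v, w)\<^sup>s)\<close> such pairs. As \<open>d\<close> is about \<open>p\<^sup>2 n\<close> on average, this contradicts \<open>p\<^sup>3 n \<gg> \<Delta>\<close>,
  and the pairs with \<open>v = w\<close> are negligible when \<open>p\<^sup>s\<^sup>+\<^sup>2 n \<gg> 1\<close>. Both conditions hold with polynomial
  room to spare, which absorbs the logarithm lost in making the degrees in \<open>B\<close> agree.
\<close>

section \<open>Sums and finite sets\<close>

lemma rearrangement_le:
  fixes a b c d :: "'a::linordered_semidom"
  assumes "a \<le> b" "c \<le> d"
  shows "a * d + b * c \<le> a * c + b * d"
proof -
  obtain x y where xy: "b = a + x" "d = c + y" "0 \<le> x" "0 \<le> y"
    using assms by (metis add.commute add_le_cancel_left add.right_neutral le_add_diff_inverse)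
  then have "a * c + b * d = a * d + b * c + x * y"
    by (simp add: algebra_simps)
  then show ?thesis using xy by simp
qed

lemma Chebyshev_sum_le:
  fixes f g :: "'i \<Rightarrow> 'a::linordered_semidom"
  assumes "\<And>i j. i \<in> I \<Longrightarrow> j \<in> I \<Longrightarrow> f i \<le> f j \<Longrightarrow> g i \<le> g j"
  shows "(\<Sum>i\<in>I. f i) * (\<Sum>i\<in>I. g i) \<le> of_nat (card I) * (\<Sum>i\<in>I. f i * g i)"
proof -
  have "(\<Sum>i\<in>I. \<Sum>j\<in>I. f j * g i) = (\<Sum>i\<in>I. \<Sum>j\<in>I. f i * g j)"
    by (rule sum.swap)
  then have "2 * ((\<Sum>i\<in>I. f i) * (\<Sum>i\<in>I. g i)) = (\<Sum>i\<in>I. \<Sum>j\<in>I. f i * g j) + (\<Sum>i\<in>I. \<Sum>j\<in>I. f j * g i)"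
    by (simp add: sum_product mult_2)
  also have "\<dots> = (\<Sum>i\<in>I. \<Sum>j\<in>I. f i * g j + f j * g i)"
    by (simp add: sum.distrib)
  also have "\<dots> \<le> (\<Sum>i\<in>I. \<Sum>j\<in>I. f i * g i + f j * g j)"
  proof (intro sum_mono)
    fix i j assume "i \<in> I" "j \<in> I"
    then show "f i * g j + f j * g i \<le> f i * g i + f j * g j"
      using assms rearrangement_le[of "f i" "f j" "g i" "g j"]
        rearrangement_le[of "f j" "f i" "g j" "g i"]
      by (cases "f i \<le> f j") (auto simp: add.commute)
  qed
  also have "\<dots> = 2 * (of_nat (card I) * (\<Sum>i\<in>I. f i * g i))"
    by (simp add: sum.distrib sum_distrib_left[symmetric] mult_2)
  finally show ?thesis by (rule mult_left_le_imp_le) simp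
qed

lemma sum_mult_sum_power_le:
  fixes f :: "'i \<Rightarrow> 'a::linordered_semidom"
  assumes "\<And>i. i \<in> I \<Longrightarrow> 0 \<le> f i"
  shows "(\<Sum>i\<in>I. f i) * (\<Sum>i\<in>I. f i ^ k) \<le> of_nat (card I) * (\<Sum>i\<in>I. f i ^ Suc k)"
  using Chebyshev_sum_le[of I f "\<lambda>i. f i ^ k"] assms by (simp add: power_mono)

lemma power_sum_le:
  fixes f :: "'i \<Rightarrow> 'a::linordered_semidom"
  assumes "\<And>i. i \<in> I \<Longrightarrow> 0 \<le> f i"
  shows "(\<Sum>i\<in>I. f i) ^ Suc k \<le> of_nat (card I) ^ k * (\<Sum>i\<in>I. f i ^ Suc k)"
proof (induction k)
  case (Suc k)
  have "(\<Sum>i\<in>I. f i) ^ Suc (Suc k) \<le> (\<Sum>i\<in>I. f i) * (of_nat (card I) ^ k * (\<Sum>i\<in>I. f i ^ Suc k))"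
    unfolding power_Suc[of _ "Suc k"] by (intro mult_left_mono Suc sum_nonneg assms)
  also have "\<dots> = of_nat (card I) ^ k * ((\<Sum>i\<in>I. f i) * (\<Sum>i\<in>I. f i ^ Suc k))"
    by (rule mult.left_commute)
  also have "\<dots> \<le> of_nat (card I) ^ k * (of_nat (card I) * (\<Sum>i\<in>I. f i ^ Suc (Suc k)))"
    by (intro mult_left_mono sum_mult_sum_power_le assms) simp_all
  finally show ?case by (simp only: power_Suc mult_ac)
qed simp

lemma sum_squared_le:
  fixes f :: "'i \<Rightarrow> nat"
  shows "(\<Sum>i\<in>I. f i)\<^sup>2 \<le> card I * (\<Sum>i\<in>I. (f i)\<^sup>2)"
  using power_sum_le[of I f 1] by (simp add: numeral_2_eq_2)

lemma square_le_mult_add_antimono: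
  fixes c x y z :: "'a::linordered_idom"
  assumes "y\<^sup>2 \<le> c * (z + y)" "0 \<le> x" "x \<le> y" "0 \<le> c" "0 \<le> z"
  shows "x\<^sup>2 \<le> c * (z + x)"
proof (cases "x \<le> c")
  case True
  then have "x * x \<le> c * (z + x)" using assms by (intro mult_mono) auto
  then show ?thesis by (simp add: power2_eq_square)
next
  case False
  then have "x * (x - c) \<le> y * (y - c)" using assms by (intro mult_mono) auto
  then show ?thesis using assms(1) by (simp add: power2_eq_square algebra_simps)
qed

lemma ex_sum_le_card_mult:
  fixes f :: "'i \<Rightarrow> 'a::linordered_semidom"
  assumes "finite I" "I \<noteq> {}"
  shows "\<exists>i\<in>I. sum f I \<le> of_nat (card I) * f i"
proof -
  have "Max (f ` I) \<in> f ` I"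
    using assms by (intro Max_in) auto
  then obtain i where i: "i \<in> I" "Max (f ` I) = f i" by auto
  then have "f j \<le> f i" if "j \<in> I" for j
    using that assms by (metis Max_ge finite_imageI imageI)
  then show ?thesis using i by (auto intro: sum_bounded_above)
qed

lemma distinct_representatives:
  assumes "finite I" "\<And>i. i \<in> I \<Longrightarrow> card I \<le> card (F i)"
  shows "\<exists>h. inj_on h I \<and> (\<forall>i\<in>I. h i \<in> F i)"
proof -
  have "\<exists>h. inj_on h J \<and> (\<forall>i\<in>J. h i \<in> F i)" if "finite J" "J \<subseteq> I" for J
    using that
  proof (induction J)
    case (insert j J)
    then obtain h where h: "inj_on h J" "\<forall>i\<in>J. h i \<in> F i"
      by auto
    have "card (h ` J) \<le> card J"
      using insert.hyps(1) by (rule card_image_le)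
    also have "\<dots> < card I"
      using insert assms(1) by (intro psubset_card_mono) auto
    also have "\<dots> \<le> card (F j)"
      using insert.prems assms(2) by simp
    finally obtain x where x: "x \<in> F j" "x \<notin> h ` J"
      using insert.hyps(1) by (metis card_mono finite_imageI leD subsetI)
    have "inj_on (h(j := x)) (insert j J)"
      using h(1) x(2) insert.hyps(2) by (auto simp: inj_on_def)
    moreover have "\<forall>i\<in>insert j J. (h(j := x)) i \<in> F i"
      using h(2) x(1) by auto
    ultimately show ?case by blast
  qed auto
  then show ?thesis using assms(1) by blast
qed

lemma ex_small_hitting_set:
  assumes "finite V" and F: "\<And>v. v \<in> V \<Longrightarrow> F v \<noteq> {} \<and> finite (F v) \<and> card (F v) \<le> c"
    and packing: "\<And>W. W \<subseteq> V \<Longrightarrow> disjoint_family_on F W \<Longrightarrow> card W \<le> t"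
  shows "\<exists>Q \<subseteq> \<Union>(F ` V). finite Q \<and> card Q \<le> t * c \<and> (\<forall>v\<in>V. F v \<inter> Q \<noteq> {})"
proof -
  let ?packings = "{W \<in> Pow V. disjoint_family_on F W}"
  have "finite ?packings" "{} \<in> ?packings"
    using assms(1) by (auto simp: disjoint_family_on_def)
  then obtain W where W: "W \<subseteq> V" "disjoint_family_on F W"
    and maximal: "\<And>W'. W' \<in> ?packings \<Longrightarrow> W \<subseteq> W' \<Longrightarrow> W = W'"
    using finite_has_maximal[of ?packings] by auto
  have finite_W: "finite W" using W(1) assms(1) finite_subset by blast
  have "card (\<Union>(F ` W)) \<le> (\<Sum>v\<in>W. card (F v))"
    by (rule card_UN_le[OF finite_W])
  also have "\<dots> \<le> card W * c"
    using sum_bounded_above[of W "\<lambda>v. card (F v)" c] F W(1) by auto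
  also have "\<dots> \<le> t * c"
    using packing[OF W] by simp
  finally have "card (\<Union>(F ` W)) \<le> t * c" .
  moreover have "F v \<inter> \<Union>(F ` W) \<noteq> {}" if "v \<in> V" for v
  proof (cases "v \<in> W")
    case True
    then show ?thesis using F that by auto
  next
    case False
    then have "\<not> disjoint_family_on F (insert v W)"
      using maximal[of "insert v W"] W(1) that by auto
    then show ?thesis
      using W(2) False by (auto simp: disjoint_family_on_insert)
  qed
  ultimately show ?thesis
    using finite_W F W(1) by (intro exI[of _ "\<Union>(F ` W)"]) blast
qed

lemma related_pair_in_non_neighbours:
  assumes "symp R" "reflp R" "finite Y" "v \<in> Y"
    and "\<And>Q. Q \<subseteq> Y \<Longrightarrow> card Q = Suc q \<Longrightarrow> \<exists>a\<in>Q. \<exists>b\<in>Q. a \<noteq> b \<and> R a b"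
    and Q: "Q \<subseteq> {u \<in> Y. \<not> R v u}" "card Q = q"
  shows "\<exists>a\<in>Q. \<exists>b\<in>Q. a \<noteq> b \<and> R a b"
proof -
  have "v \<notin> Q" "finite Q"
    using Q(1) assms(2,3) by (auto dest: reflpD intro: finite_subset)
  then have "card (insert v Q) = Suc q" using Q(2) by simp
  then obtain a b where "a \<in> insert v Q" "b \<in> insert v Q" "a \<noteq> b" "R a b"
    using assms(4) assms(5)[of "insert v Q"] Q(1) by blast
  then show ?thesis using Q(1) assms(1) by (auto dest: sympD)
qed

lemma card_pairs_ge_if_half_related:
  assumes "finite Y" "\<And>v. v \<in> Y \<Longrightarrow> card Y \<le> 2 * card {u \<in> Y. R v u}"
  shows "(card Y)\<^sup>2 \<le> 2 * card {(u, v). u \<in> Y \<and> v \<in> Y \<and> R u v}"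
proof -
  have "{(u, v). u \<in> Y \<and> v \<in> Y \<and> R u v} = (SIGMA v:Y. {u \<in> Y. R v u})" by auto
  then have "2 * card {(u, v). u \<in> Y \<and> v \<in> Y \<and> R u v} = (\<Sum>v\<in>Y. 2 * card {u \<in> Y. R v u})"
    using assms(1) by (simp add: sum_distrib_left[symmetric])
  then show ?thesis
    using assms(2) sum_mono[of Y "\<lambda>_. card Y"] by (simp add: power2_eq_square)
qed

lemma card_pairs_ge_if_no_independent_set:
  assumes "finite Y" "symp R" "reflp R"
    and "\<And>Q. Q \<subseteq> Y \<Longrightarrow> card Q = q \<Longrightarrow> \<exists>a\<in>Q. \<exists>b\<in>Q. a \<noteq> b \<and> R a b"
  shows "(card Y)\<^sup>2 \<le> 4 ^ q * card {(u, v). u \<in> Y \<and> v \<in> Y \<and> R u v}"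
  using assms(1,4)
proof (induction q arbitrary: Y)
  case 0
  from "0.prems"(2)[of "{}"] show ?case by simp
next
  case (Suc q)
  let ?pairs = "\<lambda>Y. {(u, v). u \<in> Y \<and> v \<in> Y \<and> R u v}"
  show ?case
  proof (cases "\<exists>v\<in>Y. card Y \<le> 2 * card {u \<in> Y. \<not> R v u}")
    case True
    then obtain v where v: "v \<in> Y" "card Y \<le> 2 * card {u \<in> Y. \<not> R v u}"
      by blast
    let ?Y = "{u \<in> Y. \<not> R v u}"
    have "(card Y)\<^sup>2 \<le> (2 * card ?Y)\<^sup>2"
      using v(2) by (rule power_mono) simp
    also have "\<dots> = 4 * (card ?Y)\<^sup>2"
      by (simp add: power_mult_distrib)
    also have "\<dots> \<le> 4 * (4 ^ q * card (?pairs ?Y))"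
    proof (intro mult_left_mono Suc.IH)
      show "\<exists>a\<in>Q. \<exists>b\<in>Q. a \<noteq> b \<and> R a b" if "Q \<subseteq> ?Y" "card Q = q" for Q
        using related_pair_in_non_neighbours[OF assms(2,3) Suc.prems(1) v(1) Suc.prems(2)] that
        by blast
    qed (use Suc.prems(1) in auto)
    also have "\<dots> \<le> 4 * (4 ^ q * card (?pairs Y))"
      using Suc.prems(1) by (intro mult_left_mono card_mono finite_subset[of "?pairs Y" "Y \<times> Y"]) auto
    finally show ?thesis by simp
  next
    case False
    have "card Y \<le> 2 * card {u \<in> Y. R v u}" if "v \<in> Y" for v
    proof -
      have "card Y = card {u \<in> Y. R v u} + card {u \<in> Y. \<not> R v u}"
        using Suc.prems(1) by (subst card_Un_disjoint[symmetric]) (auto intro: arg_cong[of _ _ card])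
      moreover have "2 * card {u \<in> Y. \<not> R v u} < card Y" using False that by (simp add: not_le)
      ultimately show ?thesis by linarith
    qed
    then have "(card Y)\<^sup>2 \<le> 2 * card (?pairs Y)"
      by (rule card_pairs_ge_if_half_related[OF Suc.prems(1)])
    also have "\<dots> \<le> 4 ^ Suc q * card (?pairs Y)"
      using one_le_power[of "4::nat" q] by (intro mult_right_mono) simp_all
    finally show ?thesis .
  qed
qed

lemma card_PiE_coordinate_le:
  assumes "finite I" "j \<in> I" "\<And>i. i \<in> I \<Longrightarrow> finite (U i)"
    and X: "\<And>z. finite (X z) \<and> card (X z) \<le> x"
    and determined: "\<And>z z'. (\<And>i. i \<in> I - {j} \<Longrightarrow> z i = z' i) \<Longrightarrow> X z = X z'"
  shows "card {z \<in> PiE I U. z j \<in> X z} \<le> x * (\<Prod>i\<in>I - {j}. card (U i))"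
proof -
  let ?Z = "PiE (I - {j}) U"
  have fin: "finite ?Z"
    using assms(1,3) by (intro finite_PiE) auto
  have "card {z \<in> PiE I U. z j \<in> X z} \<le> card (SIGMA g:?Z. X g)"
  proof (rule card_inj_on_le[where f = "\<lambda>z. (restrict z (I - {j}), z j)"])
    show "inj_on (\<lambda>z. (restrict z (I - {j}), z j)) {z \<in> PiE I U. z j \<in> X z}"
    proof (rule inj_onI)
      fix z z'
      assume z: "z \<in> {z \<in> PiE I U. z j \<in> X z}" "z' \<in> {z \<in> PiE I U. z j \<in> X z}"
        and eq: "(restrict z (I - {j}), z j) = (restrict z' (I - {j}), z' j)"
      have "z i = z' i" if "i \<in> I" for i
        using eq that by (cases "i = j") (auto dest: fun_cong[of _ _ i])
      then show "z = z'" using z by (auto intro: PiE_ext)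
    qed
    have "X (restrict z (I - {j})) = X z" for z by (rule determined) simp
    then show "(\<lambda>z. (restrict z (I - {j}), z j)) ` {z \<in> PiE I U. z j \<in> X z} \<subseteq> (SIGMA g:?Z. X g)"
      by (auto dest: PiE_mem split: if_splits)
    show "finite (SIGMA g:?Z. X g)"
      using fin X by (intro finite_SigmaI) auto
  qed
  also have "\<dots> = (\<Sum>g\<in>?Z. card (X g))"
    using fin X by (intro card_SigmaI) auto
  also have "\<dots> \<le> (\<Sum>g\<in>?Z. x)"
    using X by (intro sum_mono) auto
  also have "\<dots> = x * (\<Prod>i\<in>I - {j}. card (U i))"
    using assms(1) by (simp add: card_PiE mult.commute)
  finally show ?thesis .
qed

lemma card_PiE_two_coordinates:
  assumes "finite I" "i \<in> I" "j \<in> I" "i \<noteq> j"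
  shows "card {z \<in> PiE I (\<lambda>_. U). R (z i) (z j)}
    = card {(u, v). u \<in> U \<and> v \<in> U \<and> R u v} * card U ^ (card I - 2)"
proof -
  let ?P = "{(u, v). u \<in> U \<and> v \<in> U \<and> R u v}" and ?F = "PiE (I - {i, j}) (\<lambda>_. U)"
  have "bij_betw (\<lambda>z. ((z i, z j), restrict z (I - {i, j})))
      {z \<in> PiE I (\<lambda>_. U). R (z i) (z j)} (?P \<times> ?F)"
    using assms(2-4)
    by (intro bij_betw_byWitness[where f' = "\<lambda>((u, v), g). g(i := u, j := v)"])
      (auto simp: PiE_def extensional_def fun_eq_iff)
  then have "card {z \<in> PiE I (\<lambda>_. U). R (z i) (z j)} = card (?P \<times> ?F)"
    by (rule bij_betw_same_card)
  also have "card (I - {i, j}) = card I - 2"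
    using assms by (subst card_Diff_subset) auto
  then have "card (?P \<times> ?F) = card ?P * card U ^ (card I - 2)"
    using assms(1) by (simp add: card_cartesian_product card_PiE)
  finally show ?thesis .
qed

section \<open>Moments of degrees and codegrees\<close>

locale finite_relation =
  fixes A :: "'a set" and R :: "'a \<Rightarrow> 'a \<Rightarrow> bool"
  assumes finite_A: "finite A"
begin

definition nbhd :: "'a \<Rightarrow> 'a set" where
  "nbhd v = {u \<in> A. R v u}"

definition common_nbhd :: "'a \<times> 'a \<Rightarrow> 'a set" where
  "common_nbhd x = nbhd (fst x) \<inter> nbhd (snd x)"

definition centres :: "'i set \<Rightarrow> ('i \<Rightarrow> 'a) \<Rightarrow> 'a set" where
  "centres I z = {v \<in> A. \<forall>i\<in>I. R v (z i)}"

definition deg_moment :: "nat \<Rightarrow> nat" where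
  "deg_moment k = (\<Sum>v\<in>A. card (nbhd v) ^ k)"

definition codeg_moment :: "nat \<Rightarrow> nat" where
  "codeg_moment k = (\<Sum>x\<in>A \<times> A. card (common_nbhd x) ^ k)"

lemma finite_centres: "finite (centres I z)"
  using finite_A by (simp add: centres_def)

lemma finite_common_nbhd: "finite (common_nbhd x)"
  using finite_A by (simp add: common_nbhd_def nbhd_def)

lemma PiE_common_nbhd:
  assumes "x \<in> A \<times> A"
  shows "PiE I (\<lambda>_. common_nbhd x) = {z \<in> PiE I (\<lambda>_. A). x \<in> centres I z \<times> centres I z}"
  using assms by (auto simp: centres_def common_nbhd_def nbhd_def PiE_iff extensional_def)

lemma deg_moment_1: "deg_moment 1 = card {(u, v). u \<in> A \<and> v \<in> A \<and> R u v}"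
proof -
  have "{(u, v). u \<in> A \<and> v \<in> A \<and> R u v} = (SIGMA v:A. nbhd v)"
    by (auto simp: nbhd_def)
  then show ?thesis
    using finite_A by (simp add: deg_moment_def nbhd_def)
qed

lemma sum_card_centres:
  assumes "finite I"
  shows "(\<Sum>z\<in>PiE I (\<lambda>_. A). card (centres I z)) = deg_moment (card I)"
proof -
  have "(\<Sum>z\<in>PiE I (\<lambda>_. A). card (centres I z)) = (\<Sum>v\<in>A. card (PiE I (\<lambda>_. nbhd v)))"
    unfolding centres_def
  proof (rule sum_multicount_gen)
    show "\<forall>v\<in>A. card {z \<in> PiE I (\<lambda>_. A). \<forall>i\<in>I. R v (z i)} = card (PiE I (\<lambda>_. nbhd v))"
      by (auto simp: nbhd_def PiE_iff extensional_def intro!: arg_cong[of _ _ card])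
  qed (use finite_A assms in \<open>auto intro: finite_PiE\<close>)
  then show ?thesis
    using assms by (simp add: card_PiE deg_moment_def)
qed

lemma sum_card_centres_squared_over:
  assumes "finite Z"
  shows "(\<Sum>z\<in>Z. (card (centres I z))\<^sup>2) = (\<Sum>x\<in>A \<times> A. card {z \<in> Z. x \<in> centres I z \<times> centres I z})"
proof -
  have "(card (centres I z))\<^sup>2 = card {x \<in> A \<times> A. x \<in> centres I z \<times> centres I z}" for z
  proof -
    have "{x \<in> A \<times> A. x \<in> centres I z \<times> centres I z} = centres I z \<times> centres I z"
      by (auto simp: centres_def)
    then show ?thesis by (simp add: card_cartesian_product power2_eq_square)
  qed
  then show ?thesis
    using sum_multicount_gen[of Z "A \<times> A" "\<lambda>z x. x \<in> centres I z \<times> centres I z"] assms finite_A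
    by simp
qed

lemma sum_card_centres_squared:
  assumes "finite I"
  shows "(\<Sum>z\<in>PiE I (\<lambda>_. A). (card (centres I z))\<^sup>2) = codeg_moment (card I)"
proof -
  have "(\<Sum>z\<in>PiE I (\<lambda>_. A). (card (centres I z))\<^sup>2) = (\<Sum>x\<in>A \<times> A. card (PiE I (\<lambda>_. common_nbhd x)))"
    using finite_A assms
    by (subst sum_card_centres_squared_over) (auto simp: PiE_common_nbhd finite_PiE intro!: sum.cong)
  then show ?thesis
    using assms by (simp add: card_PiE codeg_moment_def)
qed

lemma deg_moment_squared_le: "(deg_moment k)\<^sup>2 \<le> card A ^ k * codeg_moment k"
  using sum_squared_le[of "\<lambda>z. card (centres {..<k} z)" "PiE {..<k} (\<lambda>_. A)"]
  by (simp add: sum_card_centres sum_card_centres_squared card_PiE)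

lemma codeg_moment_Suc_ge: "(deg_moment 1)\<^sup>2 * codeg_moment k \<le> card A ^ 3 * codeg_moment (Suc k)"
proof -
  have Suc_le: "codeg_moment 1 * codeg_moment k \<le> (card A)\<^sup>2 * codeg_moment (Suc k)"
    using sum_mult_sum_power_le[of "A \<times> A" "\<lambda>x. card (common_nbhd x)" k]
    by (simp add: codeg_moment_def card_cartesian_product power2_eq_square)
  have "(deg_moment 1)\<^sup>2 * codeg_moment k \<le> card A * (codeg_moment 1 * codeg_moment k)"
    using mult_right_mono[OF deg_moment_squared_le[of 1], of "codeg_moment k"]
    by (simp add: mult.assoc)
  also have "\<dots> \<le> card A * ((card A)\<^sup>2 * codeg_moment (Suc k))"
    by (intro mult_left_mono Suc_le) simp
  finally show ?thesis
    by (simp add: power2_eq_square power3_eq_cube mult.assoc)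
qed

lemma deg_moment_1_power_le: "deg_moment 1 ^ Suc k \<le> card A ^ k * deg_moment (Suc k)"
  using power_sum_le[of A "\<lambda>v. card (nbhd v)" k] by (simp add: deg_moment_def)

lemma codeg_moment_ge_deg_moment:
  "deg_moment 1 ^ Suc k * deg_moment (Suc k) \<le> card A ^ (2 * k + 1) * codeg_moment (Suc k)"
proof -
  have "deg_moment 1 ^ Suc k * deg_moment (Suc k) \<le> card A ^ k * (deg_moment (Suc k))\<^sup>2"
    using mult_right_mono[OF deg_moment_1_power_le, of "deg_moment (Suc k)" k]
    by (simp add: power2_eq_square mult.assoc)
  also have "\<dots> \<le> card A ^ k * (card A ^ Suc k * codeg_moment (Suc k))"
    by (intro mult_left_mono deg_moment_squared_le) simp
  also have "\<dots> = card A ^ (2 * k + 1) * codeg_moment (Suc k)"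
    by (simp add: mult_2 power_add)
  finally show ?thesis .
qed

lemma dense_codeg_moment_Suc_ge:
  fixes p :: real
  assumes "0 \<le> p" "card A \<le> n" "p * (real n)\<^sup>2 \<le> deg_moment 1"
  shows "p\<^sup>2 * n * codeg_moment k \<le> codeg_moment (Suc k)"
proof (cases "n = 0")
  case False
  have "(p * (real n)\<^sup>2)\<^sup>2 * codeg_moment k \<le> (real (deg_moment 1))\<^sup>2 * codeg_moment k"
    using assms by (intro mult_right_mono power_mono) auto
  also have "\<dots> \<le> real (card A) ^ 3 * codeg_moment (Suc k)"
    using codeg_moment_Suc_ge[of k] by (simp flip: of_nat_power of_nat_mult)
  also have "\<dots> \<le> real n ^ 3 * codeg_moment (Suc k)"
    using assms(2) by (intro mult_right_mono power_mono) auto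
  finally have "real n ^ 3 * (p\<^sup>2 * n * codeg_moment k) \<le> real n ^ 3 * codeg_moment (Suc k)"
    by (simp add: power2_eq_square power3_eq_cube mult_ac)
  then show ?thesis using False by simp
qed simp

lemma dense_codeg_moment_ge_deg_moment:
  fixes p :: real
  assumes "0 \<le> p" "card A \<le> n" "p * (real n)\<^sup>2 \<le> deg_moment 1"
  shows "p ^ Suc k * n * deg_moment (Suc k) \<le> codeg_moment (Suc k)"
proof (cases "n = 0")
  case False
  have "(p * (real n)\<^sup>2) ^ Suc k * deg_moment (Suc k)
      \<le> real (deg_moment 1) ^ Suc k * deg_moment (Suc k)"
    using assms by (intro mult_right_mono power_mono) auto
  also have "\<dots> \<le> real (card A) ^ (2 * k + 1) * codeg_moment (Suc k)"
    using codeg_moment_ge_deg_moment[of k]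
    by (simp only: of_nat_le_iff flip: of_nat_power of_nat_mult)
  also have "\<dots> \<le> real n ^ (2 * k + 1) * codeg_moment (Suc k)"
    using assms(2) by (intro mult_right_mono power_mono) auto
  finally have "real n ^ (2 * k + 1) * (p ^ Suc k * n * deg_moment (Suc k))
      \<le> real n ^ (2 * k + 1) * codeg_moment (Suc k)"
    by (simp add: power_mult_distrib power2_eq_square power_add mult_2_right mult_ac)
  then show ?thesis using False by simp
qed simp

end

section \<open>Light pairs\<close>

definition has_subdivision :: "'a set \<Rightarrow> 'b set \<Rightarrow> ('a \<Rightarrow> 'b \<Rightarrow> bool) \<Rightarrow> 'c graph \<Rightarrow> bool" where
  "has_subdivision A B E H \<longleftrightarrow>
     (\<exists>g h. inj_on g (verts H) \<and> g ` verts H \<subseteq> A \<and> inj_on h (edges H) \<and> h ` edges H \<subseteq> B \<and>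
        (\<forall>e\<in>edges H. \<forall>v\<in>e. E (g v) (h e)))"

lemma has_subdivision_if_unique:
  assumes "inj_on g (verts H)" "g ` verts H \<subseteq> A"
    and "\<And>e. e \<in> edges H \<Longrightarrow> \<exists>b\<in>B. \<forall>v\<in>e. E (g v) b"
    and "\<And>e e' b. e \<in> edges H \<Longrightarrow> e' \<in> edges H \<Longrightarrow> b \<in> B \<Longrightarrow> \<forall>v\<in>e \<union> e'. E (g v) b \<Longrightarrow> e = e'"
  shows "has_subdivision A B E H"
proof -
  obtain h where h: "\<forall>e\<in>edges H. h e \<in> B \<and> (\<forall>v\<in>e. E (g v) (h e))"
    using assms(3) by metis
  moreover have "inj_on h (edges H)"
    using h assms(4) by (metis Un_iff inj_onI)
  ultimately show ?thesis
    unfolding has_subdivision_def using assms(1,2) by blast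
qed

lemma finite_edges:
  assumes "simple_graph H"
  shows "finite (edges H)"
proof (rule finite_subset)
  show "edges H \<subseteq> Pow (verts H)" "finite (Pow (verts H))"
    using assms by (auto simp: simple_graph_def)
qed

text \<open>Pairs with at least \<open>\<kappa>\<close> common neighbours are not light: for \<open>\<kappa> = card (edges H)\<close>, a clique
  of such pairs on \<open>card (verts H)\<close> vertices yields the subdivision of \<open>H\<close> greedily.\<close>

locale bipartite_codegrees =
  fixes A :: "'a set" and B :: "'b set" and E :: "'a \<Rightarrow> 'b \<Rightarrow> bool" and \<kappa> :: nat
  assumes finite_A: "finite A" and finite_B: "finite B"
begin

definition mids :: "'a \<Rightarrow> 'a \<Rightarrow> 'b set" where
  "mids u v = {b \<in> B. E u b \<and> E v b}"

definition nbrs :: "'b \<Rightarrow> 'a set" where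
  "nbrs b = {a \<in> A. E a b}"

definition light :: "'a \<Rightarrow> 'a \<Rightarrow> bool" where
  "light u v \<longleftrightarrow> u \<noteq> v \<and> mids u v \<noteq> {} \<and> card (mids u v) < \<kappa>"

definition light_pairs :: "'a set \<Rightarrow> ('a \<times> 'a) set" where
  "light_pairs U = {(u, v). u \<in> U \<and> v \<in> U \<and> light u v}"

sublocale light: finite_relation A light
  by unfold_locales (rule finite_A)

lemma mids_commute: "mids u v = mids v u"
  by (auto simp: mids_def)

lemma finite_mids: "finite (mids u v)"
  using finite_B by (simp add: mids_def)

lemma finite_nbrs: "finite (nbrs b)"
  using finite_A by (simp add: nbrs_def)

lemma finite_light_pairs: "finite U \<Longrightarrow> finite (light_pairs U)"
  by (rule finite_subset[of _ "U \<times> U"]) (auto simp: light_pairs_def)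

lemma has_subdivision_if_heavy_clique:
  assumes H: "simple_graph H" and Q: "Q \<subseteq> A" "card Q = card (verts H)" "finite Q"
    and heavy: "\<And>u v. u \<in> Q \<Longrightarrow> v \<in> Q \<Longrightarrow> u \<noteq> v \<Longrightarrow> card (edges H) \<le> card (mids u v)"
  shows "has_subdivision A B E H"
proof -
  have "finite (verts H)" using H by (simp add: simple_graph_def)
  then obtain g where g: "bij_betw g (verts H) Q"
    using Q(2,3) by (metis finite_same_card_bij)
  let ?F = "\<lambda>e. {b \<in> B. \<forall>v\<in>e. E (g v) b}"
  have "card (edges H) \<le> card (?F e)" if "e \<in> edges H" for e
  proof -
    have "card e = 2" "e \<subseteq> verts H" using H that by (auto simp: simple_graph_def)
    then obtain x y where xy: "e = {x, y}" "x \<noteq> y" "x \<in> verts H" "y \<in> verts H"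
      by (auto simp: card_2_iff)
    then have "g x \<noteq> g y" "g x \<in> Q" "g y \<in> Q"
      using g by (auto simp: bij_betw_def inj_on_def)
    moreover have "?F e = mids (g x) (g y)"
      using xy by (auto simp: mids_def)
    ultimately show ?thesis using heavy by simp
  qed
  then obtain h where "inj_on h (edges H)" "\<forall>e\<in>edges H. h e \<in> ?F e"
    using distinct_representatives[OF finite_edges[OF H], of ?F] by blast
  then show ?thesis
    unfolding has_subdivision_def using g Q(1)
    by (intro exI[of _ g] exI[of _ h]) (auto simp: bij_betw_def)
qed

lemma sum_card_light_pairs_nbrs_le:
  assumes "U \<subseteq> A"
  shows "(\<Sum>b\<in>B. card (light_pairs (U \<inter> nbrs b))) \<le> \<kappa> * card (light_pairs U)"
proof -
  have finite_U: "finite U" using assms finite_A finite_subset by blast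
  have "light_pairs (U \<inter> nbrs b) = {x \<in> light_pairs U. b \<in> mids (fst x) (snd x)}" if "b \<in> B" for b
    using assms that by (auto simp: light_pairs_def nbrs_def mids_def)
  then have "(\<Sum>b\<in>B. card (light_pairs (U \<inter> nbrs b)))
      = (\<Sum>b\<in>B. card {x \<in> light_pairs U. b \<in> mids (fst x) (snd x)})"
    by simp
  also have "\<dots> = (\<Sum>x\<in>light_pairs U. card (mids (fst x) (snd x)))"
  proof (rule sum_multicount_gen)
    show "\<forall>x\<in>light_pairs U. card {b \<in> B. b \<in> mids (fst x) (snd x)} = card (mids (fst x) (snd x))"
      by (auto simp: mids_def intro!: arg_cong[of _ _ card])
  qed (use finite_B finite_light_pairs[OF finite_U] in auto)
  also have "\<dots> \<le> (\<Sum>x\<in>light_pairs U. \<kappa>)"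
    by (intro sum_mono) (auto simp: light_pairs_def light_def)
  finally show ?thesis by (simp add: mult.commute)
qed

end

locale heavy_clique_free = bipartite_codegrees +
  fixes q :: nat
  assumes no_heavy_clique:
    "\<And>Q. Q \<subseteq> A \<Longrightarrow> card Q = q \<Longrightarrow> \<exists>u\<in>Q. \<exists>v\<in>Q. u \<noteq> v \<and> card (mids u v) < \<kappa>"
begin

lemma card_light_pairs_of_nbrs:
  assumes "b \<in> B" "Y \<subseteq> nbrs b"
  shows "(card Y)\<^sup>2 \<le> 4 ^ q * (card (light_pairs Y) + card Y)"
proof -
  have Y: "finite Y" "Y \<subseteq> A"
    using assms(2) finite_nbrs[of b] finite_subset by (auto simp: nbrs_def)
  let ?R = "\<lambda>u v. u = v \<or> card (mids u v) < \<kappa>"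
  let ?P = "{(u, v). u \<in> Y \<and> v \<in> Y \<and> ?R u v}"
  have "(card Y)\<^sup>2 \<le> 4 ^ q * card ?P"
  proof (rule card_pairs_ge_if_no_independent_set[OF Y(1)])
    show "symp ?R" "reflp ?R"
      by (auto intro!: sympI reflpI simp: mids_commute)
    show "\<exists>u\<in>Q. \<exists>v\<in>Q. u \<noteq> v \<and> ?R u v" if "Q \<subseteq> Y" "card Q = q" for Q
      using no_heavy_clique[of Q] that Y(2) by blast
  qed
  also have "card ?P \<le> card (light_pairs Y \<union> (\<lambda>u. (u, u)) ` Y)"
  proof (rule card_mono)
    have "mids u v \<noteq> {}" if "u \<in> Y" "v \<in> Y" for u v
      using assms that by (auto simp: mids_def nbrs_def)
    then show "?P \<subseteq> light_pairs Y \<union> (\<lambda>u. (u, u)) ` Y"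
      by (auto simp: light_pairs_def light_def)
  qed (use Y finite_light_pairs in auto)
  also have "\<dots> \<le> card (light_pairs Y) + card Y"
    using card_Un_le[of "light_pairs Y" "(\<lambda>u. (u, u)) ` Y"] card_image_le[OF Y(1), of "\<lambda>u. (u, u)"]
    by linarith
  finally show ?thesis by simp
qed

lemma card_light_pairs_ge_edges:
  assumes "U \<subseteq> A"
  defines "m \<equiv> \<Sum>u\<in>U. card {b \<in> B. E u b}"
  shows "m\<^sup>2 \<le> card B * 4 ^ q * (\<kappa> * card (light_pairs U) + m)"
proof -
  have "{u \<in> U. E u b} = U \<inter> nbrs b" for b
    using assms(1) by (auto simp: nbrs_def)
  then have m: "m = (\<Sum>b\<in>B. card (U \<inter> nbrs b))"
    unfolding m_def using assms(1) finite_A finite_B finite_subset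
    by (intro sum_multicount_gen) auto
  then have "m\<^sup>2 \<le> card B * (\<Sum>b\<in>B. (card (U \<inter> nbrs b))\<^sup>2)"
    using sum_squared_le[of "\<lambda>b. card (U \<inter> nbrs b)" B] by simp
  also have "\<dots> \<le> card B * (\<Sum>b\<in>B. 4 ^ q * (card (light_pairs (U \<inter> nbrs b)) + card (U \<inter> nbrs b)))"
    by (intro mult_left_mono sum_mono card_light_pairs_of_nbrs) auto
  also have "\<dots> = card B * 4 ^ q * ((\<Sum>b\<in>B. card (light_pairs (U \<inter> nbrs b))) + m)"
    unfolding m by (simp add: sum_distrib_left[symmetric] sum.distrib)
  also have "\<dots> \<le> card B * 4 ^ q * (\<kappa> * card (light_pairs U) + m)"
    by (intro mult_left_mono add_right_mono sum_card_light_pairs_nbrs_le[OF assms(1)]) auto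
  finally show ?thesis .
qed

definition light_density :: "real \<Rightarrow> real" where
  "light_density \<delta> = \<delta>\<^sup>2 / (2 * card B * 4 ^ q * \<kappa>)"

lemma light_density_nonneg: "0 \<le> light_density \<delta>"
  by (simp add: light_density_def)

lemma light_density_mult_square_le:
  fixes \<delta> x P :: real
  assumes "0 \<le> P" "(\<delta> * x)\<^sup>2 \<le> 2 * card B * 4 ^ q * \<kappa> * P"
  shows "light_density \<delta> * x\<^sup>2 \<le> P"
proof (cases "2 * real (card B) * 4 ^ q * \<kappa> = 0")
  case False
  then have "0 < 2 * real (card B) * 4 ^ q * \<kappa>"
    by (simp add: zero_less_mult_iff)
  then show ?thesis
    using assms(2) by (simp add: light_density_def power_mult_distrib divide_le_eq mult.commute)
qed (use assms(1) in \<open>auto simp: light_density_def\<close>)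

lemma square_le_card_light_pairs:
  fixes y :: real
  assumes "U \<subseteq> A" "0 \<le> y" "y \<le> (\<Sum>u\<in>U. real (card {b \<in> B. E u b}))"
  shows "y\<^sup>2 \<le> card B * 4 ^ q * (\<kappa> * card (light_pairs U) + y)"
proof (rule square_le_mult_add_antimono)
  let ?m = "\<Sum>u\<in>U. real (card {b \<in> B. E u b})"
  have "real ((\<Sum>u\<in>U. card {b \<in> B. E u b})\<^sup>2)
      \<le> real (card B * 4 ^ q * (\<kappa> * card (light_pairs U) + (\<Sum>u\<in>U. card {b \<in> B. E u b})))"
    using card_light_pairs_ge_edges[OF assms(1)] by (simp only: of_nat_le_iff)
  then show "?m\<^sup>2 \<le> card B * 4 ^ q * (\<kappa> * card (light_pairs U) + ?m)"
    by simp
qed (use assms in simp_all)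

lemma card_light_pairs_ge_min_degree:
  fixes \<delta> :: real
  assumes "U \<subseteq> A" "0 \<le> \<delta>" "\<And>a. a \<in> U \<Longrightarrow> \<delta> \<le> card {b \<in> B. E a b}"
  shows "light_density \<delta> * (card U)\<^sup>2 \<le> card (light_pairs U) + \<delta> * card U"
proof (cases "\<kappa> = 0")
  case True
  then have "light_density \<delta> = 0" unfolding light_density_def by simp
  then show ?thesis using assms(2) by simp
next
  case False
  have "\<delta> * card U \<le> (\<Sum>u\<in>U. real (card {b \<in> B. E u b}))"
    using assms(3) sum_mono[of U "\<lambda>_. \<delta>"] by (simp add: mult.commute)
  then have "(\<delta> * card U)\<^sup>2 \<le> card B * 4 ^ q * (\<kappa> * card (light_pairs U) + \<delta> * card U)"
    using assms(1,2) by (intro square_le_card_light_pairs) auto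
  also have "\<dots> \<le> card B * 4 ^ q * (2 * \<kappa> * card (light_pairs U) + 2 * \<kappa> * (\<delta> * card U))"
  proof (intro mult_left_mono add_mono)
    show "\<delta> * card U \<le> 2 * \<kappa> * (\<delta> * card U)"
      using mult_right_mono[of 1 "2 * real \<kappa>" "\<delta> * card U"] False assms(2) by simp
  qed auto
  also have "\<dots> = 2 * card B * 4 ^ q * \<kappa> * (card (light_pairs U) + \<delta> * card U)"
    by (simp add: algebra_simps)
  finally show ?thesis
    using assms(2) light_density_mult_square_le by simp
qed

lemma deg_moment_1_ge_light_density:
  fixes \<delta> :: real
  assumes "card B \<le> n" "2 * 4 ^ q \<le> \<delta>" "n * \<delta> \<le> (\<Sum>a\<in>A. real (card {b \<in> B. E a b}))"
  shows "light_density \<delta> * (real n)\<^sup>2 \<le> light.deg_moment 1"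
proof -
  have \<delta>: "0 \<le> \<delta>" using assms(2) order.trans[of 0 "2 * 4 ^ q" \<delta>] by simp
  have "2 * (card B * 4 ^ q) * (n * \<delta>) \<le> (n * \<delta>) * (n * \<delta>)"
  proof (rule mult_right_mono)
    have "real (card B) * (2 * 4 ^ q) \<le> n * \<delta>"
      using assms(1,2) by (intro mult_mono) auto
    then show "2 * (card B * 4 ^ q) \<le> n * \<delta>" by simp
  qed (use \<delta> in simp)
  moreover have "(n * \<delta>)\<^sup>2 \<le> card B * 4 ^ q * (\<kappa> * card (light_pairs A) + n * \<delta>)"
    using assms(3) \<delta> by (intro square_le_card_light_pairs) auto
  ultimately have "(\<delta> * n)\<^sup>2 \<le> 2 * card B * 4 ^ q * \<kappa> * card (light_pairs A)"
    by (simp add: power2_eq_square algebra_simps)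
  then have "light_density \<delta> * (real n)\<^sup>2 \<le> card (light_pairs A)"
    by (intro light_density_mult_square_le) auto
  then show ?thesis
    by (simp only: light.deg_moment_1 light_pairs_def)
qed

lemma mult_max_degree_le_light_density:
  fixes \<delta> :: real
  assumes "0 < card B" "0 < \<kappa>" "0 \<le> \<delta>" "card B * D \<le> 2 * real n * \<delta>"
  shows "\<delta> * D \<le> light_density \<delta> * (4 * 4 ^ q * \<kappa>) * n"
proof -
  have "real (card B) * D * \<delta> \<le> 2 * real n * \<delta> * \<delta>"
    using assms(3,4) by (intro mult_right_mono) auto
  then have "\<delta> * D \<le> 2 * real n * \<delta>\<^sup>2 / card B"
    using assms(1) by (simp add: le_divide_eq power2_eq_square mult_ac)
  also have "\<dots> = light_density \<delta> * (4 * 4 ^ q * \<kappa>) * n"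
    using assms(2) by (simp add: light_density_def)
  finally show ?thesis .
qed

end

section \<open>Tuples and clashes\<close>

text \<open>A tuple \<open>z\<close> is a candidate for the images of \<open>RV, SV 0, \<dots>, SV (s - 1)\<close>, in this order, and
  its centres are the candidates for the images of the vertices \<open>TV j\<close>.\<close>

locale light_tuples = bipartite_codegrees +
  fixes s :: nat
begin

definition tuples :: "(nat \<Rightarrow> 'a) set" where
  "tuples = {z \<in> PiE {..s} (\<lambda>_. A). light (z 0) (z 1)}"

abbreviation centres :: "(nat \<Rightarrow> 'a) \<Rightarrow> 'a set" where
  "centres \<equiv> light.centres {..s}"

definition spokes :: "(nat \<Rightarrow> 'a) \<Rightarrow> 'a \<Rightarrow> 'b set" where
  "spokes z v = (\<Union>i\<le>s. mids v (z i))"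

definition separated_centres :: "(nat \<Rightarrow> 'a) \<Rightarrow> 'a set" where
  "separated_centres z = {v \<in> centres z. disjoint_family_on (\<lambda>i. mids v (z i)) {..s}}"

text \<open>A pair \<open>(v, w)\<close> of centres clashes if some vertex of \<open>B\<close> is adjacent to \<open>v\<close>, to some \<open>z j\<close>, and
  either to \<open>w\<close> (with \<open>v, w\<close> light) or to another \<open>z i\<close>. The set \<open>blocked\<close> isolates the condition
  this puts on \<open>z j\<close>: it is small and does not depend on \<open>z j\<close>, so that the tuples for which \<open>(v, w)\<close>
  clashes can be counted.\<close>

definition near :: "'a \<Rightarrow> 'a \<Rightarrow> 'a set" where
  "near u v = {a \<in> A. light u v \<and> (\<exists>b\<in>mids u v. E a b)}"

definition blocked :: "'a \<times> 'a \<Rightarrow> (nat \<Rightarrow> 'a) \<Rightarrow> nat \<Rightarrow> 'a set" where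
  "blocked x z j = near (fst x) (snd x) \<union> (\<Union>i\<in>{..s} - {j}. near (fst x) (z i))"

definition clash_pairs :: "(nat \<Rightarrow> 'a) \<Rightarrow> ('a \<times> 'a) set" where
  "clash_pairs z = {x \<in> centres z \<times> centres z. \<exists>j\<le>s. z j \<in> blocked x z j}"

lemma finite_tuples: "finite tuples"
  unfolding tuples_def using finite_A by (simp add: finite_PiE)

lemma finite_separated_centres: "finite (separated_centres z)"
  by (simp add: separated_centres_def light.finite_centres)

lemma finite_clash_pairs: "finite (clash_pairs z)"
  by (simp add: clash_pairs_def light.finite_centres)

lemma tuples_in_A: "z \<in> tuples \<Longrightarrow> i \<le> s \<Longrightarrow> z i \<in> A"
  by (auto simp: tuples_def)

lemma card_near_le:
  assumes "\<And>b. b \<in> B \<Longrightarrow> card (nbrs b) \<le> \<Delta>"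
  shows "card (near u v) \<le> \<kappa> * \<Delta>"
proof (cases "light u v")
  case True
  have "card (near u v) \<le> card (\<Union>b\<in>mids u v. nbrs b)"
    by (intro card_mono) (auto simp: near_def nbrs_def finite_mids finite_A)
  also have "\<dots> \<le> (\<Sum>b\<in>mids u v. card (nbrs b))"
    by (rule card_UN_le[OF finite_mids])
  also have "\<dots> \<le> (\<Sum>b\<in>mids u v. \<Delta>)"
    using assms by (intro sum_mono) (auto simp: mids_def)
  also have "\<dots> \<le> \<kappa> * \<Delta>"
    using True by (simp add: light_def)
  finally show ?thesis .
qed (simp add: near_def)

lemma card_blocked_le:
  assumes "\<And>b. b \<in> B \<Longrightarrow> card (nbrs b) \<le> \<Delta>" "j \<le> s"
  shows "card (blocked x z j) \<le> Suc s * (\<kappa> * \<Delta>)"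
proof -
  have "card (blocked x z j)
      \<le> card (near (fst x) (snd x)) + card (\<Union>i\<in>{..s} - {j}. near (fst x) (z i))"
    unfolding blocked_def by (rule card_Un_le)
  also have "card (\<Union>i\<in>{..s} - {j}. near (fst x) (z i)) \<le> (\<Sum>i\<in>{..s} - {j}. card (near (fst x) (z i)))"
    by (rule card_UN_le) simp
  also have "\<dots> \<le> (\<Sum>i\<in>{..s} - {j}. \<kappa> * \<Delta>)"
    by (intro sum_mono card_near_le assms(1))
  also have "\<dots> = s * (\<kappa> * \<Delta>)"
    using assms(2) by simp
  finally show ?thesis
    using card_near_le[OF assms(1), of "fst x" "snd x"] by simp
qed

lemma sum_card_clash_pairs_le:
  assumes "\<And>b. b \<in> B \<Longrightarrow> card (nbrs b) \<le> \<Delta>"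
  shows "(\<Sum>z\<in>PiE {..s} (\<lambda>_. A). card (clash_pairs z)) \<le> (Suc s)\<^sup>2 * (\<kappa> * \<Delta>) * light.codeg_moment s"
proof -
  let ?Z = "PiE {..s} (\<lambda>_. A)"
  have "(\<Sum>z\<in>?Z. card (clash_pairs z)) = (\<Sum>z\<in>?Z. card {x \<in> A \<times> A. x \<in> clash_pairs z})"
    by (intro sum.cong refl arg_cong[of _ _ card]) (auto simp: clash_pairs_def light.centres_def)
  also have "\<dots> = (\<Sum>x\<in>A \<times> A. card {z \<in> ?Z. x \<in> clash_pairs z})"
    using finite_A by (intro sum_multicount_gen) (auto intro: finite_PiE)
  also have "\<dots> \<le> (\<Sum>x\<in>A \<times> A. (Suc s)\<^sup>2 * (\<kappa> * \<Delta>) * card (light.common_nbhd x) ^ s)"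
  proof (rule sum_mono)
    fix x assume x: "x \<in> A \<times> A"
    let ?blocked = "\<lambda>j. {z \<in> PiE {..s} (\<lambda>_. light.common_nbhd x). z j \<in> blocked x z j}"
    have "{z \<in> ?Z. x \<in> clash_pairs z} = (\<Union>j\<le>s. ?blocked j)"
      unfolding light.PiE_common_nbhd[OF x] clash_pairs_def by blast
    then have "card {z \<in> ?Z. x \<in> clash_pairs z} \<le> (\<Sum>j\<le>s. card (?blocked j))"
      using card_UN_le[of "{..s}" ?blocked] by simp
    also have "\<dots> \<le> (\<Sum>j\<le>s. Suc s * (\<kappa> * \<Delta>) * (\<Prod>i\<in>{..s} - {j}. card (light.common_nbhd x)))"
    proof (intro sum_mono card_PiE_coordinate_le conjI card_blocked_le assms)
      show "finite (blocked x z j)" for z j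
        using finite_A by (simp add: blocked_def near_def)
      show "blocked x z j = blocked x z' j" if "\<And>i. i \<in> {..s} - {j} \<Longrightarrow> z i = z' i" for z z' j
        using that by (simp add: blocked_def)
    qed (auto simp: light.finite_common_nbhd)
    also have "\<dots> = (Suc s)\<^sup>2 * (\<kappa> * \<Delta>) * card (light.common_nbhd x) ^ s"
      by (simp add: power2_eq_square algebra_simps)
    finally show "card {z \<in> ?Z. x \<in> clash_pairs z} \<le> \<dots>" .
  qed
  finally show ?thesis
    by (simp add: light.codeg_moment_def sum_distrib_left)
qed

lemma sum_tuples_card_centres_squared:
  assumes "1 \<le> s"
  shows "(\<Sum>z\<in>tuples. (card (centres z))\<^sup>2)
    = (\<Sum>x\<in>A \<times> A. card (light_pairs (light.common_nbhd x)) * card (light.common_nbhd x) ^ (s - 1))"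
proof -
  have "card {z \<in> tuples. x \<in> centres z \<times> centres z}
      = card (light_pairs (light.common_nbhd x)) * card (light.common_nbhd x) ^ (s - 1)"
    if x: "x \<in> A \<times> A" for x
  proof -
    have "{z \<in> tuples. x \<in> centres z \<times> centres z}
        = {z \<in> PiE {..s} (\<lambda>_. light.common_nbhd x). light (z 0) (z 1)}"
      unfolding light.PiE_common_nbhd[OF x] tuples_def by blast
    then show ?thesis
      using assms card_PiE_two_coordinates[of "{..s}" 0 1 "light.common_nbhd x" light]
      by (simp add: light_pairs_def)
  qed
  then show ?thesis
    by (subst light.sum_card_centres_squared_over[OF finite_tuples]) (intro sum.cong refl)
qed

lemma clash_pairs_if_not_separated:
  assumes "z \<in> tuples" "v \<in> centres z - separated_centres z" "w \<in> centres z"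
  shows "(v, w) \<in> clash_pairs z"
proof -
  obtain i j b where ij: "i \<le> s" "j \<le> s" "i \<noteq> j" and b: "b \<in> mids v (z i)" "b \<in> mids v (z j)"
    using assms(2) by (auto simp: separated_centres_def disjoint_family_on_def)
  then have "z j \<in> near v (z i)"
    using assms(1,2) tuples_in_A by (auto simp: near_def mids_def light.centres_def)
  then have "z j \<in> blocked (v, w) z j"
    using ij by (auto simp: blocked_def)
  then show ?thesis
    using assms(2,3) ij by (auto simp: clash_pairs_def)
qed

lemma light_pairs_of_nbrs_subset_clash_pairs:
  assumes "z \<in> tuples" "Y \<subseteq> centres z" "Y \<subseteq> nbrs b" "b \<in> spokes z v"
  shows "light_pairs Y \<subseteq> clash_pairs z"
proof
  fix x assume x: "x \<in> light_pairs Y"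
  obtain j where j: "j \<le> s" "b \<in> B" "E (z j) b"
    using assms(4) by (auto simp: spokes_def mids_def)
  have "b \<in> mids (fst x) (snd x)"
    using x assms(3) j(2) by (auto simp: light_pairs_def mids_def nbrs_def)
  then have "z j \<in> near (fst x) (snd x)"
    using x j tuples_in_A[OF assms(1)] by (auto simp: light_pairs_def near_def)
  then show "x \<in> clash_pairs z"
    using x j assms(2) by (auto simp: light_pairs_def clash_pairs_def blocked_def)
qed

end

definition packing_const :: "nat \<Rightarrow> nat \<Rightarrow> nat \<Rightarrow> nat \<Rightarrow> nat" where
  "packing_const \<kappa> q s t = ((t * (Suc s * \<kappa>))\<^sup>2 * 4 ^ q + 2) * ((Suc s)\<^sup>2 * \<kappa> + 1)"

locale spoke_packing_free = heavy_clique_free A B E \<kappa> q + light_tuples A B E \<kappa> s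
  for A :: "'a set" and B :: "'b set" and E \<kappa> q s +
  fixes t :: nat
  assumes s_ge_1: "1 \<le> s"
    and packing: "\<And>z W. z \<in> tuples \<Longrightarrow> W \<subseteq> separated_centres z
      \<Longrightarrow> disjoint_family_on (spokes z) W \<Longrightarrow> card W \<le> t"
begin

lemma ex_spoke_hitting_set:
  assumes "z \<in> tuples"
  shows "\<exists>Q. finite Q \<and> card Q \<le> t * (Suc s * \<kappa>) \<and> (\<forall>b\<in>Q. b \<in> B \<and> (\<exists>v. b \<in> spokes z v))
    \<and> separated_centres z \<subseteq> (\<Union>b\<in>Q. nbrs b)"
proof -
  have "\<exists>Q \<subseteq> \<Union>(spokes z ` separated_centres z). finite Q \<and> card Q \<le> t * (Suc s * \<kappa>)
      \<and> (\<forall>v\<in>separated_centres z. spokes z v \<inter> Q \<noteq> {})"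
  proof (rule ex_small_hitting_set)
    show "finite (separated_centres z)"
      by (rule finite_separated_centres)
    fix v assume v: "v \<in> separated_centres z"
    then have spoke: "light v (z i)" if "i \<le> s" for i
      using that by (simp add: separated_centres_def light.centres_def)
    have "card (spokes z v) \<le> (\<Sum>i\<le>s. card (mids v (z i)))"
      unfolding spokes_def by (rule card_UN_le) simp
    also have "\<dots> \<le> (\<Sum>i\<le>s. \<kappa>)"
      using spoke by (intro sum_mono) (auto simp: light_def less_imp_le)
    finally show "spokes z v \<noteq> {} \<and> finite (spokes z v) \<and> card (spokes z v) \<le> Suc s * \<kappa>"
      using spoke[of 0] by (auto simp: spokes_def finite_mids light_def)
  qed (use packing[OF assms] in blast)
  then obtain Q where Q: "Q \<subseteq> \<Union>(spokes z ` separated_centres z)" "finite Q" "card Q \<le> t * (Suc s * \<kappa>)"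
    and hit: "\<forall>v\<in>separated_centres z. spokes z v \<inter> Q \<noteq> {}"
    by auto
  have "v \<in> (\<Union>b\<in>Q. nbrs b)" if v: "v \<in> separated_centres z" for v
  proof -
    obtain b where "b \<in> spokes z v" "b \<in> Q" using hit v by auto
    then show ?thesis
      using v by (auto simp: spokes_def mids_def nbrs_def separated_centres_def light.centres_def)
  qed
  moreover have "\<forall>b\<in>Q. b \<in> B \<and> (\<exists>v. b \<in> spokes z v)"
    using Q(1) by (auto simp: spokes_def mids_def)
  ultimately show ?thesis using Q(2,3) by blast
qed

lemma card_separated_centres_squared_le:
  assumes "z \<in> tuples"
  shows "(card (separated_centres z))\<^sup>2
    \<le> (t * (Suc s * \<kappa>))\<^sup>2 * 4 ^ q * (card (clash_pairs z) + card (centres z))"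
proof -
  obtain Q where Q: "finite Q" "card Q \<le> t * (Suc s * \<kappa>)" "\<forall>b\<in>Q. b \<in> B \<and> (\<exists>v. b \<in> spokes z v)"
    and cover: "separated_centres z \<subseteq> (\<Union>b\<in>Q. nbrs b)"
    using ex_spoke_hitting_set[OF assms] by blast
  let ?Y = "\<lambda>b. separated_centres z \<inter> nbrs b"
  let ?m = "card (clash_pairs z) + card (centres z)"
  have Y: "(card (?Y b))\<^sup>2 \<le> 4 ^ q * ?m" if b: "b \<in> Q" for b
  proof -
    have Y: "?Y b \<subseteq> centres z" by (auto simp: separated_centres_def)
    have "(card (?Y b))\<^sup>2 \<le> 4 ^ q * (card (light_pairs (?Y b)) + card (?Y b))"
      using Q(3) b by (intro card_light_pairs_of_nbrs) auto
    also have "\<dots> \<le> 4 ^ q * ?m"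
      using Q(3) b light_pairs_of_nbrs_subset_clash_pairs[OF assms Y]
      by (intro mult_left_mono add_mono card_mono finite_clash_pairs light.finite_centres Y) auto
    finally show ?thesis .
  qed
  have "separated_centres z = (\<Union>b\<in>Q. ?Y b)" using cover by auto
  then have "card (separated_centres z) \<le> (\<Sum>b\<in>Q. card (?Y b))"
    using card_UN_le[OF Q(1), of ?Y] by simp
  then have "(card (separated_centres z))\<^sup>2 \<le> (\<Sum>b\<in>Q. card (?Y b))\<^sup>2"
    by (rule power_mono) simp
  also have "\<dots> \<le> card Q * (\<Sum>b\<in>Q. (card (?Y b))\<^sup>2)"
    by (rule sum_squared_le)
  also have "\<dots> \<le> card Q * (\<Sum>b\<in>Q. 4 ^ q * ?m)"
    by (intro mult_left_mono sum_mono Y) auto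
  also have "\<dots> = (card Q)\<^sup>2 * 4 ^ q * ?m"
    by (simp add: power2_eq_square)
  also have "\<dots> \<le> (t * (Suc s * \<kappa>))\<^sup>2 * 4 ^ q * ?m"
    using Q(2) by (intro mult_right_mono power_mono) auto
  finally show ?thesis .
qed

lemma card_centres_squared_le:
  assumes "z \<in> tuples"
  shows "(card (centres z))\<^sup>2
    \<le> ((t * (Suc s * \<kappa>))\<^sup>2 * 4 ^ q + 2) * (card (clash_pairs z) + card (centres z))"
proof -
  let ?S = "separated_centres z" and ?C = "clash_pairs z"
  have "centres z \<times> centres z \<subseteq> ?S \<times> ?S \<union> (?C \<union> prod.swap ` ?C)"
    using clash_pairs_if_not_separated[OF assms] by (force simp: image_iff)
  then have "card (centres z \<times> centres z) \<le> card (?S \<times> ?S \<union> (?C \<union> prod.swap ` ?C))"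
    by (intro card_mono) (simp_all add: finite_separated_centres finite_clash_pairs)
  also have "\<dots> \<le> card (?S \<times> ?S) + (card ?C + card (prod.swap ` ?C))"
    by (intro order.trans[OF card_Un_le] add_left_mono card_Un_le)
  also have "\<dots> = (card ?S)\<^sup>2 + 2 * card ?C"
    by (simp add: card_cartesian_product power2_eq_square card_image)
  finally show ?thesis
    using card_separated_centres_squared_le[OF assms]
    by (simp add: card_cartesian_product power2_eq_square algebra_simps)
qed

lemma sum_tuples_card_centres_squared_le:
  assumes "\<And>b. b \<in> B \<Longrightarrow> card (nbrs b) \<le> \<Delta>"
  shows "(\<Sum>z\<in>tuples. (card (centres z))\<^sup>2) \<le> ((t * (Suc s * \<kappa>))\<^sup>2 * 4 ^ q + 2)
    * ((Suc s)\<^sup>2 * \<kappa> * (\<Delta> * light.codeg_moment s) + light.deg_moment (Suc s))"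
proof -
  let ?c = "(t * (Suc s * \<kappa>))\<^sup>2 * 4 ^ q + 2" and ?Z = "PiE {..s} (\<lambda>_. A)"
  have Z: "finite ?Z" "tuples \<subseteq> ?Z" using finite_A by (auto simp: finite_PiE tuples_def)
  have "(\<Sum>z\<in>tuples. (card (centres z))\<^sup>2)
      \<le> (\<Sum>z\<in>tuples. ?c * (card (clash_pairs z) + card (centres z)))"
    by (intro sum_mono card_centres_squared_le)
  also have "\<dots> \<le> (\<Sum>z\<in>?Z. ?c * (card (clash_pairs z) + card (centres z)))"
    by (intro sum_mono2 Z) simp
  also have "\<dots> = ?c * ((\<Sum>z\<in>?Z. card (clash_pairs z)) + (\<Sum>z\<in>?Z. card (centres z)))"
    by (simp only: sum.distrib sum_distrib_left[symmetric])
  also have "\<dots> \<le> ?c * ((Suc s)\<^sup>2 * (\<kappa> * \<Delta>) * light.codeg_moment s + light.deg_moment (Suc s))"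
    using light.sum_card_centres[of "{..s}"]
    by (intro mult_left_mono add_mono sum_card_clash_pairs_le assms) auto
  finally show ?thesis by (simp only: mult.assoc)
qed

lemma sum_tuples_card_centres_squared_ge:
  fixes \<delta> :: real
  assumes "0 \<le> \<delta>" "\<And>a. a \<in> A \<Longrightarrow> \<delta> \<le> card {b \<in> B. E a b}"
  shows "light_density \<delta> * light.codeg_moment (Suc s)
    \<le> (\<Sum>z\<in>tuples. (card (centres z))\<^sup>2) + \<delta> * light.codeg_moment s"
proof -
  let ?d = "\<lambda>x. card (light.common_nbhd x)" and ?l = "\<lambda>x. card (light_pairs (light.common_nbhd x))"
  have "light_density \<delta> * light.codeg_moment (Suc s)
      = (\<Sum>x\<in>A \<times> A. light_density \<delta> * (?d x)\<^sup>2 * real (?d x) ^ (s - 1))"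
    using s_ge_1
    by (cases s)
      (simp_all add: light.codeg_moment_def sum_distrib_left power2_eq_square mult.assoc)
  also have "\<dots> \<le> (\<Sum>x\<in>A \<times> A. (?l x + \<delta> * ?d x) * real (?d x) ^ (s - 1))"
    using assms by (intro sum_mono mult_right_mono card_light_pairs_ge_min_degree)
      (auto simp: light.common_nbhd_def light.nbhd_def)
  also have "\<dots> = real (\<Sum>x\<in>A \<times> A. ?l x * ?d x ^ (s - 1)) + \<delta> * light.codeg_moment s"
    using s_ge_1
    by (cases s) (simp_all add: light.codeg_moment_def sum_distrib_left sum.distrib algebra_simps)
  finally show ?thesis
    by (simp only: sum_tuples_card_centres_squared[OF s_ge_1])
qed

lemma codeg_moment_Suc_le:
  fixes \<delta> :: real
  assumes "0 \<le> \<delta>" "\<delta> \<le> \<Delta>" "\<And>a. a \<in> A \<Longrightarrow> \<delta> \<le> card {b \<in> B. E a b}"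
    and "\<And>b. b \<in> B \<Longrightarrow> card (nbrs b) \<le> \<Delta>"
  shows "light_density \<delta> * light.codeg_moment (Suc s)
    \<le> packing_const \<kappa> q s t * (real \<Delta> * light.codeg_moment s + light.deg_moment (Suc s))"
proof -
  let ?c = "(t * (Suc s * \<kappa>))\<^sup>2 * 4 ^ q + 2"
  let ?M = "light.codeg_moment s" and ?D = "light.deg_moment (Suc s)"
  have "light_density \<delta> * light.codeg_moment (Suc s) \<le> (\<Sum>z\<in>tuples. (card (centres z))\<^sup>2) + \<delta> * ?M"
    by (intro sum_tuples_card_centres_squared_ge assms)
  also have "\<dots> \<le> real (\<Sum>z\<in>tuples. (card (centres z))\<^sup>2) + real \<Delta> * ?M"
    using assms(2) by (intro add_left_mono mult_right_mono) auto
  also have "\<dots> \<le> real (?c * ((Suc s)\<^sup>2 * \<kappa> * (\<Delta> * ?M) + ?D)) + real \<Delta> * ?M"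
    by (intro add_right_mono of_nat_mono sum_tuples_card_centres_squared_le assms)
  also have "\<dots> = real (?c * ((Suc s)\<^sup>2 * \<kappa> * (\<Delta> * ?M) + ?D) + \<Delta> * ?M)"
    by simp
  also have "\<dots> \<le> real (?c * ((Suc s)\<^sup>2 * \<kappa> + 1) * (\<Delta> * ?M + ?D))"
    by (intro of_nat_mono) (simp add: algebra_simps)
  finally show ?thesis
    by (simp only: packing_const_def of_nat_mult of_nat_add)
qed

lemma light_density_dichotomy:
  fixes \<delta> :: real
  assumes "card A \<le> n" "card B \<le> n" "2 * 4 ^ q \<le> \<delta>" "\<delta> \<le> \<Delta>"
    and "\<And>a. a \<in> A \<Longrightarrow> \<delta> \<le> card {b \<in> B. E a b}" "\<And>b. b \<in> B \<Longrightarrow> card (nbrs b) \<le> \<Delta>"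
    and "n * \<delta> \<le> (\<Sum>a\<in>A. real (card {b \<in> B. E a b}))"
  shows "light_density \<delta> ^ 3 * n \<le> 2 * packing_const \<kappa> q s t * \<Delta>
    \<or> light_density \<delta> ^ (s + 2) * n \<le> 2 * packing_const \<kappa> q s t"
proof (rule ccontr)
  define p where "p = light_density \<delta>"
  let ?C = "packing_const \<kappa> q s t" and ?M = "light.codeg_moment" and ?D = "light.deg_moment"
  assume "\<not> ?thesis"
  then have large: "2 * ?C * \<Delta> \<le> p ^ 3 * n" "2 * ?C < p ^ (s + 2) * n"
    by (auto simp: p_def)
  have "0 \<le> p" by (simp add: p_def light_density_nonneg)
  note dense = \<open>0 \<le> p\<close> assms(1) deg_moment_1_ge_light_density[OF assms(2,3,7), folded p_def]
  have \<delta>: "0 \<le> \<delta>" using assms(3) order.trans[of 0 "2 * 4 ^ q" \<delta>] by simp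
  have "0 < p ^ (s + 2) * n" using large(2) by (rule le_less_trans[rotated]) simp
  then have "0 < p" "0 < n" using \<open>0 \<le> p\<close> by (auto simp: zero_less_mult_iff)

  have upper: "p * ?M (Suc s) \<le> ?C * (real \<Delta> * ?M s + ?D (Suc s))"
    unfolding p_def by (intro codeg_moment_Suc_le assms \<delta>)

  have "real (2 * ?C * \<Delta>) * ?M s \<le> p ^ 3 * n * ?M s"
    using large(1) by (intro mult_right_mono) auto
  also have "\<dots> = p * (p\<^sup>2 * n * ?M s)"
    by (simp add: power2_eq_square power3_eq_cube)
  also have "\<dots> \<le> p * ?M (Suc s)"
    by (intro mult_left_mono light.dense_codeg_moment_Suc_ge dense)
  finally have codeg: "real (2 * ?C * \<Delta>) * ?M s \<le> p * ?M (Suc s)" .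

  have "0 < p * (real n)\<^sup>2" using \<open>0 < p\<close> \<open>0 < n\<close> by simp
  then have "0 < ?D 1" using dense(3) by linarith
  then have "0 < ?D (Suc s)"
    using light.deg_moment_1_power_le[of s] by (cases "?D (Suc s)") simp_all
  then have "real (2 * ?C) * ?D (Suc s) < p ^ (s + 2) * n * ?D (Suc s)"
    using large(2) by (intro mult_strict_right_mono) auto
  also have "\<dots> = p * (p ^ Suc s * n * ?D (Suc s))"
    by simp
  also have "\<dots> \<le> p * ?M (Suc s)"
    by (intro mult_left_mono light.dense_codeg_moment_ge_deg_moment dense)
  finally have "real (2 * ?C) * ?D (Suc s) < p * ?M (Suc s)" .
  with codeg upper show False by (simp add: algebra_simps)
qed

end

section \<open>Embedding the subdivision\<close>

text \<open>The vertices of \<open>K_plus s t\<close> adjacent to all \<open>TV j\<close>, indexed by \<open>{..s}\<close> like the tuples above.\<close>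

fun S_side :: "nat \<Rightarrow> kvertex" where
  "S_side 0 = RV"
| "S_side (Suc i) = SV i"

lemma verts_K_plus: "verts (K_plus s t) = S_side ` {..s} \<union> TV ` {..<t}"
proof -
  have "S_side ` {..s} = insert RV (SV ` {..<s})"
    by (auto simp: lessThan_Suc_atMost[symmetric] lessThan_Suc_eq_insert_0 image_image)
  then show ?thesis by (auto simp: K_plus_def)
qed

lemma edges_K_plus_cases:
  assumes "e \<in> edges (K_plus s t)"
  obtains "e = {S_side 0, S_side 1}" | i j where "i \<le> s" "j < t" "e = {S_side i, TV j}"
proof -
  consider "e = {RV, SV 0}" | i j where "i < s" "j < t" "e = {SV i, TV j}"
    | j where "j < t" "e = {RV, TV j}"
    using assms by (auto simp: K_plus_def)
  then show thesis
  proof cases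
    case 1
    then show thesis by (intro that(1)) simp
  next
    case (2 i j)
    then show thesis by (intro that(2)[of "Suc i" j]) simp_all
  next
    case (3 j)
    then show thesis by (intro that(2)[of 0 j]) simp_all
  qed
qed

lemma K_plus_edges_eq:
  assumes "1 \<le> s" "e \<in> edges (K_plus s t)" "e' \<in> edges (K_plus s t)" "e \<subseteq> N" "e' \<subseteq> N"
    and unique: "\<And>i j k l. i \<le> s \<Longrightarrow> k \<le> s \<Longrightarrow> j < t \<Longrightarrow> l < t \<Longrightarrow>
      {S_side i, TV j} \<subseteq> N \<Longrightarrow> {S_side k, TV l} \<subseteq> N \<Longrightarrow> i = k \<and> j = l"
  shows "e = e'"
proof -
  have root: "f = {S_side 0, S_side 1}"
    if f: "f \<in> edges (K_plus s t)" "f \<subseteq> N" and "{S_side 0, S_side 1} \<subseteq> N" for f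
    using f(1)
  proof (cases rule: edges_K_plus_cases)
    case (2 i j)
    then show ?thesis using unique[of 0 1 j j] that(2,3) assms(1) by simp
  qed
  show ?thesis
    using assms(2)
  proof (cases rule: edges_K_plus_cases)
    case 1
    then show ?thesis using root[OF assms(3,5)] assms(4) by simp
  next
    case ij: (2 i j)
    show ?thesis
      using assms(3)
    proof (cases rule: edges_K_plus_cases)
      case 1
      then show ?thesis using root[OF assms(2,4)] assms(5) by simp
    next
      case (2 k l)
      then show ?thesis using unique[of i k j l] ij assms(4,5) by simp
    qed
  qed
qed

fun K_plus_map :: "(nat \<Rightarrow> 'a) \<Rightarrow> (nat \<Rightarrow> 'a) \<Rightarrow> kvertex \<Rightarrow> 'a" where
  "K_plus_map z w RV = z 0"
| "K_plus_map z w (SV i) = z (Suc i)"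
| "K_plus_map z w (TV j) = w j"

lemma K_plus_map_S_side [simp]: "K_plus_map z w (S_side i) = z i"
  by (cases i) simp_all

lemma (in bipartite_codegrees) has_subdivision_K_plus:
  assumes "1 \<le> s" "0 < t"
    and in_A: "\<And>i. i \<le> s \<Longrightarrow> z i \<in> A" "\<And>j. j < t \<Longrightarrow> w j \<in> A"
    and light: "light (z 0) (z 1)" "\<And>i j. i \<le> s \<Longrightarrow> j < t \<Longrightarrow> light (w j) (z i)"
    and unique: "\<And>i j k l b. i \<le> s \<Longrightarrow> k \<le> s \<Longrightarrow> j < t \<Longrightarrow> l < t \<Longrightarrow>
      b \<in> mids (w j) (z i) \<Longrightarrow> b \<in> mids (w l) (z k) \<Longrightarrow> i = k \<and> j = l"
  shows "has_subdivision A B E (K_plus s t)"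
proof (rule has_subdivision_if_unique)
  let ?g = "K_plus_map z w"
  have z_inj: "i = k" if "i \<le> s" "k \<le> s" "z i = z k" for i k
    using light(2)[of i 0] unique[of i k 0 0] that assms(2) by (auto simp: light_def)
  have w_inj: "j = l" if "j < t" "l < t" "w j = w l" for j l
    using light(2)[of 0 j] unique[of 0 0 j l] that by (auto simp: light_def)
  have w_neq_z: "w j \<noteq> z i" if "i \<le> s" "j < t" for i j
    using light(2)[OF that] by (auto simp: light_def)
  show "inj_on ?g (verts (K_plus s t))"
    unfolding verts_K_plus
    using w_neq_z w_neq_z[symmetric] by (intro inj_onI) (auto dest: z_inj w_inj)
  show "?g ` verts (K_plus s t) \<subseteq> A"
    using in_A by (auto simp: verts_K_plus)
  show "\<exists>b\<in>B. \<forall>v\<in>e. E (?g v) b" if "e \<in> edges (K_plus s t)" for e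
    using that
  proof (cases rule: edges_K_plus_cases)
    case 1
    then show ?thesis
      using light(1) by (auto simp: light_def mids_def simp del: S_side.simps One_nat_def)
  next
    case (2 i j)
    then show ?thesis
      using light(2)[of i j] by (auto simp: light_def mids_def)
  qed
  show "e = e'" if "e \<in> edges (K_plus s t)" "e' \<in> edges (K_plus s t)"
    and b: "b \<in> B" "\<forall>v\<in>e \<union> e'. E (?g v) b" for e e' b
  proof (rule K_plus_edges_eq[where N = "{v. E (?g v) b}", OF assms(1) that(1,2)])
    fix i j k l
    assume "i \<le> s" "k \<le> s" "j < t" "l < t"
      "{S_side i, TV j} \<subseteq> {v. E (?g v) b}" "{S_side k, TV l} \<subseteq> {v. E (?g v) b}"
    then show "i = k \<and> j = l"
      using b(1) by (intro unique[of i k j l b]) (simp_all add: mids_def)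
  qed (use b(2) in auto)
qed

lemma (in light_tuples) has_subdivision_if_spoke_packing:
  assumes "1 \<le> s" "0 < t" "z \<in> tuples"
    and "W \<subseteq> separated_centres z" "disjoint_family_on (spokes z) W" "card W = t"
  shows "has_subdivision A B E (K_plus s t)"
proof -
  have "finite W" using assms(4) finite_separated_centres finite_subset by blast
  then obtain w where w: "bij_betw w {..<t} W"
    using assms(6) by (metis card_lessThan finite_lessThan finite_same_card_bij)
  have centre: "w j \<in> centres z" "disjoint_family_on (\<lambda>i. mids (w j) (z i)) {..s}" if "j < t" for j
    using w that assms(4) by (auto simp: bij_betw_def separated_centres_def)
  show ?thesis
  proof (rule has_subdivision_K_plus[OF assms(1,2)])
    show "z i \<in> A" if "i \<le> s" for i
      using assms(3) that by (rule tuples_in_A)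
    show "w j \<in> A" "\<And>i. i \<le> s \<Longrightarrow> light (w j) (z i)" if "j < t" for j
      using centre(1)[OF that] by (auto simp: light.centres_def)
    show "light (z 0) (z 1)"
      using assms(3) by (simp add: tuples_def)
    fix i j k l b
    assume ij: "i \<le> s" "k \<le> s" "j < t" "l < t" and b: "b \<in> mids (w j) (z i)" "b \<in> mids (w l) (z k)"
    then have "b \<in> spokes z (w j) \<inter> spokes z (w l)"
      by (auto simp: spokes_def)
    then have "w j = w l"
      using assms(5) w ij(3,4) by (auto simp: disjoint_family_on_def bij_betw_def)
    then have "j = l"
      using w ij(3,4) by (auto simp: bij_betw_def inj_on_def)
    moreover have "i = k"
      using centre(2)[OF ij(3)] ij(1,2) b \<open>j = l\<close> by (auto simp: disjoint_family_on_def)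
    ultimately show "i = k \<and> j = l" by simp
  qed
qed

lemma spoke_packing_free_if_no_subdivision:
  assumes "1 \<le> s" "0 < t" "finite A" "finite B" and free: "\<not> has_subdivision A B E (K_plus s t)"
  shows "spoke_packing_free A B E (card (edges (K_plus s t))) (card (verts (K_plus s t))) s t"
proof -
  interpret light_tuples A B E "card (edges (K_plus s t))" s
    using assms(3,4) by unfold_locales
  have simple: "simple_graph (K_plus s t)"
    using assms(1) by (intro simple_graph_K_plus) simp
  show ?thesis
  proof
    fix Q assume Q: "Q \<subseteq> A" "card Q = card (verts (K_plus s t))"
    have "finite Q" using Q(1) assms(3) finite_subset by blast
    then show "\<exists>u\<in>Q. \<exists>v\<in>Q. u \<noteq> v \<and> card (mids u v) < card (edges (K_plus s t))"
      using has_subdivision_if_heavy_clique[OF simple Q] free by (meson not_le)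
  next
    fix z W assume W: "z \<in> tuples" "W \<subseteq> separated_centres z" "disjoint_family_on (spokes z) W"
    show "card W \<le> t"
    proof (rule ccontr)
      assume "\<not> card W \<le> t"
      then obtain V where V: "V \<subseteq> W" "card V = t"
        by (metis nat_le_linear obtain_subset_with_card_n)
      then have "has_subdivision A B E (K_plus s t)"
        using W disjoint_family_on_mono[OF V(1) W(3)]
        by (intro has_subdivision_if_spoke_packing[OF assms(1,2), of z V]) auto
      then show False using free by simp
    qed
  qed (rule assms)
qed

lemma contains_copy_subdivision:
  assumes "has_subdivision A B E H" "A \<inter> B = {}" "A \<union> B \<subseteq> verts G" "simple_graph H"
    and "\<And>a b. a \<in> A \<Longrightarrow> b \<in> B \<Longrightarrow> E a b \<Longrightarrow> {a, b} \<in> edges G"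
  shows "contains_copy G (subdivision H)"
proof -
  obtain g h where inj: "inj_on g (verts H)" "inj_on h (edges H)"
    and image: "g ` verts H \<subseteq> A" "h ` edges H \<subseteq> B" and E: "\<forall>e\<in>edges H. \<forall>v\<in>e. E (g v) (h e)"
    using assms(1) unfolding has_subdivision_def by (elim exE conjE) (rule that)
  let ?f = "case_sum g h"
  have "g u \<noteq> h e" if "u \<in> verts H" "e \<in> edges H" for u e
    using image assms(2) that by (metis disjoint_iff image_subset_iff)
  then have "inj_on ?f (Inl ` verts H \<union> Inr ` edges H)"
    using inj by (fastforce simp: inj_on_def)
  moreover have "?f ` (Inl ` verts H \<union> Inr ` edges H) \<subseteq> verts G"
    using image assms(3) by (simp add: image_Un image_image) blast
  moreover have "?f ` {Inl v, Inr e} \<in> edges G" if "e \<in> edges H" "v \<in> e" for v e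
  proof -
    have "e \<subseteq> verts H" using assms(4) that(1) by (simp add: simple_graph_def)
    then have "g v \<in> A" "h e \<in> B" "E (g v) (h e)"
      using image E that by blast+
    then show ?thesis using assms(5) by simp
  qed
  ultimately show ?thesis
    unfolding contains_copy_def subdivision_def by (intro exI[of _ ?f]) auto
qed

lemma spoke_packing_free_if_not_contains_copy:
  assumes "1 \<le> s" "0 < t" "simple_graph G" "A \<inter> B = {}" "A \<union> B \<subseteq> verts G"
    and free: "\<not> contains_copy G (subdivision (K_plus s t))"
  shows "spoke_packing_free A B (\<lambda>a b. {a, b} \<in> edges G)
    (card (edges (K_plus s t))) (card (verts (K_plus s t))) s t"
proof (rule spoke_packing_free_if_no_subdivision[OF assms(1,2)])
  show "finite A" "finite B"
    using assms(3,5) by (auto simp: simple_graph_def intro: finite_subset)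
  have "simple_graph (K_plus s t)"
    using assms(1) by (intro simple_graph_K_plus) simp
  then show "\<not> has_subdivision A B (\<lambda>a b. {a, b} \<in> edges G) (K_plus s t)"
    using contains_copy_subdivision[OF _ assms(4,5)] free by blast
qed

section \<open>Reduction to almost regular bipartite graphs\<close>

lemma card_separating_subsets:
  assumes "finite V" "a \<in> V" "a \<noteq> b"
  shows "2 * card {X \<in> Pow V. (a \<in> X) \<noteq> (b \<in> X)} = 2 ^ card V"
proof -
  let ?sep = "{X \<in> Pow V. (a \<in> X) \<noteq> (b \<in> X)}" and ?nonsep = "{X \<in> Pow V. (a \<in> X) = (b \<in> X)}"
  let ?toggle = "\<lambda>X. if a \<in> X then X - {a} else insert a X"
  have "bij_betw ?toggle ?sep ?nonsep"
    using assms(2,3) by (intro bij_betw_byWitness[where f' = ?toggle]) auto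
  then have "card ?sep = card ?nonsep" by (rule bij_betw_same_card)
  moreover have "card ?sep + card ?nonsep = card (Pow V)"
    using assms(1) by (subst card_Un_disjoint[symmetric]) (auto intro: arg_cong[of _ _ card])
  ultimately show ?thesis using assms(1) by (simp add: card_Pow)
qed

lemma ex_large_cut:
  assumes "finite V" "\<And>e. e \<in> E \<Longrightarrow> e \<subseteq> V \<and> card e = 2"
  shows "\<exists>X\<subseteq>V. card E \<le> 2 * card {e \<in> E. \<exists>a\<in>X. \<exists>b\<in>V - X. e = {a, b}}"
proof -
  let ?cut = "\<lambda>X. {e \<in> E. \<exists>a\<in>X. \<exists>b\<in>V - X. e = {a, b}}"
  have "finite E"
    using assms by (intro finite_subset[of E "Pow V"]) auto
  have half: "2 * card {X \<in> Pow V. e \<in> ?cut X} = 2 ^ card V" if e: "e \<in> E" for e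
  proof -
    obtain a b where ab: "e = {a, b}" "a \<noteq> b" "a \<in> V" "b \<in> V"
      using assms(2)[OF e] by (auto simp: card_2_iff)
    then have "{X \<in> Pow V. e \<in> ?cut X} = {X \<in> Pow V. (a \<in> X) \<noteq> (b \<in> X)}"
      using e by (auto simp: doubleton_eq_iff)
    then show ?thesis using card_separating_subsets[OF assms(1) ab(3,2)] by simp
  qed
  have "(\<Sum>X\<in>Pow V. 2 * card (?cut X)) = 2 * (\<Sum>X\<in>Pow V. card {e \<in> E. e \<in> ?cut X})"
    by (simp add: sum_distrib_left)
  also have "\<dots> = 2 * (\<Sum>e\<in>E. card {X \<in> Pow V. e \<in> ?cut X})"
    using assms(1) \<open>finite E\<close> by (intro arg_cong[of _ _ "\<lambda>m. 2 * m"] sum_multicount_gen) auto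
  also have "\<dots> = (\<Sum>e\<in>E. 2 ^ card V)"
    unfolding sum_distrib_left by (intro sum.cong refl half)
  finally have "(\<Sum>X\<in>Pow V. 2 * card (?cut X)) = 2 ^ card V * card E"
    by simp
  moreover obtain X where "X \<in> Pow V"
    "(\<Sum>X\<in>Pow V. 2 * card (?cut X)) \<le> of_nat (card (Pow V)) * (2 * card (?cut X))"
    using ex_sum_le_card_mult[of "Pow V" "\<lambda>X. 2 * card (?cut X)"] assms(1) by auto
  ultimately show ?thesis
    using assms(1) by (intro exI[of _ X]) (simp add: card_Pow)
qed

lemma ex_large_bipartition:
  assumes "simple_graph G"
  shows "\<exists>X\<subseteq>verts G. card (edges G) \<le> 2 * (\<Sum>b\<in>verts G - X. card {a \<in> X. {a, b} \<in> edges G})"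
proof -
  have finite_V: "finite (verts G)" and edges: "\<And>e. e \<in> edges G \<Longrightarrow> e \<subseteq> verts G \<and> card e = 2"
    using assms by (auto simp: simple_graph_def)
  let ?cut = "\<lambda>X. {e \<in> edges G. \<exists>a\<in>X. \<exists>b\<in>verts G - X. e = {a, b}}"
  obtain X where X: "X \<subseteq> verts G" "card (edges G) \<le> 2 * card (?cut X)"
    using ex_large_cut[OF finite_V edges] by blast
  have finite_X: "finite X" using X(1) finite_V finite_subset by blast
  let ?P = "SIGMA b:verts G - X. {a \<in> X. {a, b} \<in> edges G}"
  have "card (?cut X) \<le> card ?P"
  proof (rule surj_card_le)
    show "finite ?P" using finite_V finite_X by auto
    show "?cut X \<subseteq> (\<lambda>(b, a). {a, b}) ` ?P" by force
  qed
  also have "\<dots> = (\<Sum>b\<in>verts G - X. card {a \<in> X. {a, b} \<in> edges G})"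
    using finite_V finite_X by (intro card_SigmaI) auto
  finally show ?thesis using X by (intro exI[of _ X]) auto
qed

lemma ex_dyadic_part:
  fixes f :: "'a \<Rightarrow> nat"
  assumes "finite Y" "\<And>b. b \<in> Y \<Longrightarrow> f b \<le> n"
  shows "\<exists>B\<subseteq>Y. \<exists>D. (\<forall>b\<in>B. D \<le> f b \<and> f b \<le> 2 * D) \<and> sum f Y \<le> Suc (floor_log n) * sum f B"
proof -
  let ?part = "\<lambda>i. {b \<in> {b \<in> Y. 0 < f b}. floor_log (f b) = i}"
  have "sum f Y = sum f {b \<in> Y. 0 < f b}"
    using assms(1) by (intro sum.mono_neutral_right) auto
  also have "\<dots> = (\<Sum>i\<le>floor_log n. sum f (?part i))"
    using assms by (intro sum.group[symmetric]) (auto intro: floor_log_le_iff)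
  finally obtain i where "sum f Y \<le> Suc (floor_log n) * sum f (?part i)"
    using ex_sum_le_card_mult[of "{..floor_log n}" "\<lambda>i. sum f (?part i)"] by auto
  moreover have "\<forall>b\<in>?part i. 2 ^ i \<le> f b \<and> f b \<le> 2 * 2 ^ i"
    using floor_log_exp2_le floor_log_exp2_ge by auto
  moreover have "?part i \<subseteq> Y" by auto
  ultimately show ?thesis by blast
qed

lemma average_of_dyadic_part:
  fixes f :: "'a \<Rightarrow> nat" and \<delta> :: real
  assumes D: "\<And>b. b \<in> B \<Longrightarrow> D \<le> f b \<and> f b \<le> 2 * D" and "card B \<le> n" "0 < n"
    and \<delta>: "2 * real n * \<delta> = real (sum f B)"
  shows "card B * D \<le> 2 * real n * \<delta>" "\<delta> \<le> D"
proof -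
  have "card B * D \<le> sum f B"
    using sum_mono[of B "\<lambda>_. D" f] D by simp
  then show "card B * D \<le> 2 * real n * \<delta>" unfolding \<delta> by (rule of_nat_mono)
  have "sum f B \<le> card B * (2 * D)"
    using sum_bounded_above[of B f "2 * D"] D by auto
  also have "\<dots> \<le> n * (2 * D)" using assms(2) by (rule mult_right_mono) simp
  finally have "2 * real n * \<delta> \<le> real (n * (2 * D))" unfolding \<delta> by (rule of_nat_mono)
  then show "\<delta> \<le> D" using assms(3) by simp
qed

lemma sum_le_sum_large_terms:
  fixes f :: "'a \<Rightarrow> real" and c :: real
  assumes "finite X" "0 \<le> c"
  shows "sum f X \<le> sum f {x \<in> X. c \<le> f x} + card X * c"
proof -
  have "X = {x \<in> X. c \<le> f x} \<union> {x \<in> X. f x < c}" by auto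
  then have "sum f X = sum f {x \<in> X. c \<le> f x} + sum f {x \<in> X. f x < c}"
    using assms(1) by (subst sum.union_disjoint[symmetric]) auto
  also have "sum f {x \<in> X. f x < c} \<le> card {x \<in> X. f x < c} * c"
    using sum_bounded_above[of "{x \<in> X. f x < c}" f c] by auto
  also have "\<dots> \<le> card X * c"
    using assms by (intro mult_right_mono of_nat_mono card_mono) auto
  finally show ?thesis by simp
qed

definition almost_regular :: "nat \<Rightarrow> 'a set \<Rightarrow> 'b set \<Rightarrow> ('a \<Rightarrow> 'b \<Rightarrow> bool) \<Rightarrow> real \<Rightarrow> nat \<Rightarrow> bool" where
  "almost_regular n A B E \<delta> D \<longleftrightarrow>
     card A \<le> n \<and> card B \<le> n \<and> B \<noteq> {} \<and> \<delta> \<le> real D \<and> card B * D \<le> 2 * real n * \<delta> \<and>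
     (\<forall>a\<in>A. \<delta> \<le> real (card {b \<in> B. E a b})) \<and> (\<forall>b\<in>B. card {a \<in> A. E a b} \<le> 2 * D) \<and>
     real n * \<delta> \<le> (\<Sum>a\<in>A. real (card {b \<in> B. E a b}))"

lemma ex_min_degree_part:
  fixes E :: "'a \<Rightarrow> 'b \<Rightarrow> bool" and \<delta> :: real
  assumes "finite X" "finite B" "card X \<le> n" "0 \<le> \<delta>"
    and edges: "2 * real n * \<delta> \<le> (\<Sum>b\<in>B. real (card {a \<in> X. E a b}))"
  shows "\<exists>A\<subseteq>X. (\<forall>a\<in>A. \<delta> \<le> card {b \<in> B. E a b}) \<and> n * \<delta> \<le> (\<Sum>a\<in>A. real (card {b \<in> B. E a b}))"
proof -
  define A where "A = {a \<in> X. \<delta> \<le> card {b \<in> B. E a b}}"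
  have "(\<Sum>a\<in>X. card {b \<in> B. E a b}) = (\<Sum>b\<in>B. card {a \<in> X. E a b})"
    using assms(1,2) by (intro sum_multicount_gen) auto
  then have "(\<Sum>b\<in>B. real (card {a \<in> X. E a b})) = (\<Sum>a\<in>X. real (card {b \<in> B. E a b}))"
    by (simp flip: of_nat_sum)
  also have "\<dots> \<le> (\<Sum>a\<in>A. real (card {b \<in> B. E a b})) + card X * \<delta>"
    unfolding A_def by (rule sum_le_sum_large_terms[OF assms(1,4)])
  also have "card X * \<delta> \<le> n * \<delta>"
    using assms(3,4) by (intro mult_right_mono) auto
  finally show ?thesis
    using edges by (intro exI[of _ A]) (auto simp: A_def)
qed

lemma ex_almost_regular_bipartite:
  fixes E :: "'a \<Rightarrow> 'b \<Rightarrow> bool" and d :: real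
  assumes fin: "finite X" "finite Y" and card: "card X \<le> n" "card Y \<le> n"
    and pos: "0 < n" "0 < d"
    and dense: "2 * real n * d * Suc (floor_log n) \<le> (\<Sum>b\<in>Y. real (card {a \<in> X. E a b}))"
  shows "\<exists>A\<subseteq>X. \<exists>B\<subseteq>Y. \<exists>\<delta>\<ge>d. \<exists>D. almost_regular n A B E \<delta> D"
proof -
  let ?deg = "\<lambda>b. card {a \<in> X. E a b}"
  have "?deg b \<le> n" for b
    using card_mono[of X "{a \<in> X. E a b}"] fin(1) card(1) by auto
  then obtain B D where "B \<subseteq> Y" and D: "\<forall>b\<in>B. D \<le> ?deg b \<and> ?deg b \<le> 2 * D"
    and dyadic: "sum ?deg Y \<le> Suc (floor_log n) * sum ?deg B"
    using ex_dyadic_part[OF fin(2), of ?deg n] by blast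
  define \<delta> where "\<delta> = real (sum ?deg B) / (2 * n)"
  have B: "finite B" "card B \<le> n"
    using \<open>B \<subseteq> Y\<close> fin(2) card(2) card_mono[of Y B] finite_subset by auto
  have \<delta>: "2 * real n * \<delta> = real (sum ?deg B)" using pos(1) by (simp add: \<delta>_def)

  have "2 * real n * d * Suc (floor_log n) \<le> real (sum ?deg Y)" using dense by simp
  also have "\<dots> \<le> real (Suc (floor_log n) * sum ?deg B)"
    using dyadic by (rule of_nat_mono)
  also have "\<dots> = 2 * real n * \<delta> * Suc (floor_log n)"
    unfolding \<delta> by (simp only: of_nat_mult mult.commute)
  finally have d: "d \<le> \<delta>" using pos(1) by simp
  then have "0 < \<delta>" using pos(2) by simp

  have bounds: "card B * D \<le> 2 * real n * \<delta>" "\<delta> \<le> D"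
    using average_of_dyadic_part[of B D ?deg n \<delta>] D B(2) pos(1) \<delta> by auto
  obtain A where A: "A \<subseteq> X" "\<forall>a\<in>A. \<delta> \<le> card {b \<in> B. E a b}"
    "real n * \<delta> \<le> (\<Sum>a\<in>A. real (card {b \<in> B. E a b}))"
    using ex_min_degree_part[OF fin(1) B(1) card(1), of \<delta> E] \<delta> \<open>0 < \<delta>\<close> by auto
  have "card {a \<in> A. E a b} \<le> ?deg b" for b
    using A(1) fin(1) by (intro card_mono) auto
  then have "card {a \<in> A. E a b} \<le> 2 * D" if "b \<in> B" for b
    using that D by (blast intro: order.trans)
  moreover have "card A \<le> n"
    using card_mono[OF fin(1) A(1)] card(1) by simp
  moreover have "B \<noteq> {}" using \<open>0 < \<delta>\<close> by (auto simp: \<delta>_def)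
  ultimately have "almost_regular n A B E \<delta> D"
    using A B(2) bounds by (auto simp: almost_regular_def)
  then show ?thesis using A(1) \<open>B \<subseteq> Y\<close> d by blast
qed

lemma ex_almost_regular_cut:
  fixes G :: "'a graph" and d :: real
  assumes G: "simple_graph G" "card (verts G) = n" and pos: "0 < n" "0 < d"
    and edges: "4 * real n * d * Suc (floor_log n) \<le> card (edges G)"
  shows "\<exists>A B. A \<union> B \<subseteq> verts G \<and> A \<inter> B = {} \<and>
    (\<exists>\<delta>\<ge>d. \<exists>D. almost_regular n A B (\<lambda>a b. {a, b} \<in> edges G) \<delta> D)"
proof -
  let ?E = "\<lambda>a b. {a, b} \<in> edges G"
  have finite_V: "finite (verts G)" using G(1) by (simp add: simple_graph_def)
  obtain X where X: "X \<subseteq> verts G"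
    and cut: "card (edges G) \<le> 2 * (\<Sum>b\<in>verts G - X. card {a \<in> X. ?E a b})"
    using ex_large_bipartition[OF G(1)] by blast
  have "4 * real n * d * Suc (floor_log n) \<le> real (2 * (\<Sum>b\<in>verts G - X. card {a \<in> X. ?E a b}))"
    using edges of_nat_mono[OF cut] by (rule order.trans)
  then have dense:
    "2 * real n * d * Suc (floor_log n) \<le> (\<Sum>b\<in>verts G - X. real (card {a \<in> X. ?E a b}))"
    by (simp add: mult_ac del: of_nat_Suc)
  have parts: "finite X" "finite (verts G - X)" "card X \<le> n" "card (verts G - X) \<le> n"
    using G(2) X finite_V card_mono[OF finite_V] finite_subset by auto
  obtain A B where "A \<subseteq> X" "B \<subseteq> verts G - X" "\<exists>\<delta>\<ge>d. \<exists>D. almost_regular n A B ?E \<delta> D"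
    using ex_almost_regular_bipartite[OF parts pos dense] by blast
  then show ?thesis using X by (intro exI[of _ A] exI[of _ B]) auto
qed

lemma power5_le_if_cube_mult_le:
  fixes c d x y :: real
  assumes "0 < d" "d \<le> x" "d \<le> y" "(x * y) ^ 3 \<le> y * c"
  shows "d ^ 5 \<le> c"
proof -
  have "0 < y" using assms(1,3) by linarith
  have "y * (x ^ 3 * y\<^sup>2) \<le> y * c"
    using assms(4) by (simp add: power_mult_distrib power2_eq_square power3_eq_cube mult_ac)
  then have "x ^ 3 * y\<^sup>2 \<le> c" using \<open>0 < y\<close> by simp
  moreover have "d ^ 3 * d\<^sup>2 \<le> x ^ 3 * y\<^sup>2"
    using assms(1-3) by (intro mult_mono power_mono) auto
  ultimately show ?thesis by (simp flip: power_add)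
qed

lemma (in spoke_packing_free) almost_regular_dichotomy:
  fixes d \<delta> :: real and n D :: nat
  defines "R \<equiv> 4 * 4 ^ q * \<kappa>"
  assumes "0 < \<kappa>" and d: "2 * 4 ^ q \<le> d" "d \<le> \<delta>" and regular: "almost_regular n A B E \<delta> D"
  shows "d ^ 5 \<le> 4 * packing_const \<kappa> q s t * R ^ 3 * n ^ 2
    \<or> d ^ (2 * s + 4) \<le> 2 * packing_const \<kappa> q s t * R ^ (s + 2) * n ^ (s + 1)"
proof -
  define p where "p = light_density \<delta>"
  let ?C = "packing_const \<kappa> q s t"
  have D: "\<delta> \<le> D" "card B * D \<le> 2 * real n * \<delta>" and "0 < card B"
    using regular finite_B by (auto simp: almost_regular_def card_gt_0_iff)
  have "0 < d" using d(1) by (rule less_le_trans[rotated]) simp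
  have "0 \<le> \<delta>" using d(2) \<open>0 < d\<close> by linarith
  then have "\<delta> * D \<le> p * R * n"
    using mult_max_degree_le_light_density[OF \<open>0 < card B\<close> \<open>0 < \<kappa>\<close> _ D(2)] by (simp add: p_def R_def)
  then have power_le: "(\<delta> * D) ^ k \<le> p ^ k * R ^ k * n ^ k" for k
    using power_mono[of "\<delta> * D" "p * R * n" k] \<open>0 \<le> \<delta>\<close> by (simp add: power_mult_distrib)

  have "p ^ 3 * n \<le> 2 * ?C * (2 * D) \<or> p ^ (s + 2) * n \<le> 2 * ?C"
    unfolding p_def
    by (rule light_density_dichotomy) (use d regular in \<open>auto simp: almost_regular_def nbrs_def\<close>)
  then show ?thesis
  proof
    assume p: "p ^ 3 * n \<le> 2 * ?C * (2 * D)"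
    have "(\<delta> * D) ^ 3 \<le> p ^ 3 * n * (R ^ 3 * n\<^sup>2)"
      using power_le[of 3] by (simp add: power2_eq_square power3_eq_cube mult_ac)
    also have "\<dots> \<le> real (2 * ?C * (2 * D)) * (R ^ 3 * n\<^sup>2)"
      using p by (rule mult_right_mono) simp
    finally have "(\<delta> * D) ^ 3 \<le> D * real (4 * ?C * R ^ 3 * n ^ 2)"
      by (simp add: mult_ac)
    then show ?thesis
      using d(2) D(1) \<open>0 < d\<close> by (intro disjI1 power5_le_if_cube_mult_le[of d \<delta> "real D"]) auto
  next
    assume p: "p ^ (s + 2) * n \<le> 2 * ?C"
    have "2 * s + 4 = 2 * (s + 2)" by simp
    then have "d ^ (2 * s + 4) = (d * d) ^ (s + 2)" by (simp only: power_mult power2_eq_square)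
    also have "\<dots> \<le> (\<delta> * D) ^ (s + 2)"
      using d D(1) \<open>0 < d\<close> \<open>0 \<le> \<delta>\<close> by (intro power_mono mult_mono) auto
    also have "\<dots> \<le> p ^ (s + 2) * n * (R ^ (s + 2) * n ^ (s + 1))"
      using power_le[of "s + 2"] by (simp add: mult_ac)
    also have "\<dots> \<le> real (2 * ?C) * (R ^ (s + 2) * n ^ (s + 1))"
      using p by (rule mult_right_mono) simp
    finally show ?thesis by (simp add: mult.assoc)
  qed
qed

lemma subdivision_K_plus_free_dichotomy:
  fixes s t :: nat
  assumes "1 \<le> s" "0 < t"
  shows "\<exists>M::real. \<forall>(G::'a graph) n (d::real). simple_graph G \<longrightarrow> card (verts G) = n
    \<longrightarrow> \<not> contains_copy G (subdivision (K_plus s t)) \<longrightarrow> 0 < n \<longrightarrow> 0 < d \<longrightarrow> M \<le> d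
    \<longrightarrow> 4 * real n * d * Suc (floor_log n) \<le> card (edges G)
    \<longrightarrow> d ^ 5 \<le> M * n ^ 2 \<or> d ^ (2 * s + 4) \<le> M * n ^ (s + 1)"
proof -
  define q where "q = card (verts (K_plus s t))"
  define \<kappa> where "\<kappa> = card (edges (K_plus s t))"
  define C where "C = packing_const \<kappa> q s t"
  define R :: nat where "R = 4 * 4 ^ q * \<kappa>"
  define M where "M = real (2 * 4 ^ q + 4 * C * R ^ 3 + 2 * C * R ^ (s + 2))"
  have M: "real (2 * 4 ^ q) \<le> M" "real (4 * C * R ^ 3) \<le> M" "real (2 * C * R ^ (s + 2)) \<le> M"
    unfolding M_def by (intro of_nat_mono; simp)+
  have "edges (K_plus s t) \<noteq> {}" by (auto simp: K_plus_def)
  then have \<kappa>: "0 < \<kappa>"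
    using assms(1) finite_edges[OF simple_graph_K_plus] by (simp add: \<kappa>_def card_gt_0_iff)
  have "d ^ 5 \<le> M * n ^ 2 \<or> d ^ (2 * s + 4) \<le> M * n ^ (s + 1)"
    if G: "simple_graph G" "card (verts G) = n" "\<not> contains_copy G (subdivision (K_plus s t))"
      and d: "0 < n" "0 < d" "M \<le> d" "4 * real n * d * Suc (floor_log n) \<le> card (edges G)"
    for G :: "'a graph" and n and d :: real
  proof -
    obtain A B D \<delta> where AB: "A \<union> B \<subseteq> verts G" "A \<inter> B = {}"
      and \<delta>: "d \<le> \<delta>" and regular: "almost_regular n A B (\<lambda>a b. {a, b} \<in> edges G) \<delta> D"
      using ex_almost_regular_cut[OF G(1,2) d(1,2,4)] by blast
    interpret spoke_packing_free A B "\<lambda>a b. {a, b} \<in> edges G" \<kappa> q s t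
      unfolding \<kappa>_def q_def
      by (rule spoke_packing_free_if_not_contains_copy[OF assms G(1) AB(2,1) G(3)])
    have "2 * 4 ^ q \<le> d" using order.trans[OF M(1) d(3)] by simp
    then have "d ^ 5 \<le> 4 * C * R ^ 3 * n ^ 2 \<or> d ^ (2 * s + 4) \<le> 2 * C * R ^ (s + 2) * n ^ (s + 1)"
      unfolding C_def R_def by (rule almost_regular_dichotomy[OF \<kappa> _ \<delta> regular])
    moreover have "real (4 * C * R ^ 3 * n ^ 2) \<le> M * n ^ 2"
      "real (2 * C * R ^ (s + 2) * n ^ (s + 1)) \<le> M * n ^ (s + 1)"
      unfolding of_nat_mult[of _ "n ^ 2"] of_nat_mult[of _ "n ^ (s + 1)"]
      using M(2,3) by (intro mult_right_mono; simp)+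
    ultimately show ?thesis by (blast intro: order.trans)
  qed
  then show ?thesis by blast
qed

section \<open>Asymptotics\<close>

lemma eventually_const_mult_power_less_powr:
  assumes "real k < real m * \<gamma>"
  shows "\<forall>\<^sub>F n in sequentially. M * real n ^ k < (real n powr \<gamma>) ^ m"
proof -
  have "\<forall>\<^sub>F n in sequentially. M < real n powr (m * \<gamma> - k)"
    using assms by real_asymp
  then show ?thesis
    using eventually_gt_at_top[of 0]
  proof eventually_elim
    case (elim n)
    then have "M * real n ^ k < real n powr (m * \<gamma> - k) * real n ^ k"
      by (intro mult_strict_right_mono) auto
    also have "\<dots> = (real n powr \<gamma>) ^ m"
      using elim(2) by (simp add: powr_diff powr_power powr_realpow mult.commute)
    finally show ?case .
  qed
qed

lemma eventually_floor_log_le_powr: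
  fixes \<epsilon> :: real
  assumes "0 < \<epsilon>"
  shows "\<forall>\<^sub>F n in sequentially. 4 * real (Suc (floor_log n)) \<le> real n powr \<epsilon>"
proof -
  have "\<forall>\<^sub>F n in sequentially. 4 * (log 2 (real n) + 1) \<le> real n powr \<epsilon>"
    using assms by real_asymp
  then show ?thesis
    using eventually_gt_at_top[of 0]
  proof eventually_elim
    case (elim n)
    have "2 powr real (floor_log n) \<le> real n"
      using floor_log_exp2_le[OF elim(2)] by (simp add: powr_realpow flip: of_nat_le_iff)
    then have "real (floor_log n) \<le> log 2 (real n)"
      using elim(2) by (simp add: le_log_iff)
    then show ?case using elim(1) by simp
  qed
qed

lemma ex_exponent:
  fixes x :: real
  assumes "1 \<le> x"
  shows "\<exists>\<gamma>. \<gamma> < (x\<^sup>2 + 1) / (2 * x + 2 * x\<^sup>2) \<and> 2 < 5 * \<gamma> \<and> x + 1 < (2 * x + 4) * \<gamma>"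
proof -
  define \<alpha> where "\<alpha> = (x\<^sup>2 + 1) / (2 * x + 2 * x\<^sup>2)"
  have pos: "0 < 2 * x + 2 * x\<^sup>2" "0 < 2 * x + 4" using assms by (auto intro: add_pos_nonneg)
  have "0 < (x - 2)\<^sup>2 + 1" by (simp add: add_nonneg_pos)
  then have "2 / 5 < \<alpha>"
    using pos by (simp add: \<alpha>_def less_divide_eq power2_eq_square algebra_simps)
  moreover have "(x + 1) * (2 * x + 2 * x\<^sup>2) < (x\<^sup>2 + 1) * (2 * x + 4)"
    by (simp add: power2_eq_square algebra_simps)
  then have "(x + 1) / (2 * x + 4) < \<alpha>"
    unfolding \<alpha>_def by (simp only: pos divide_less_eq less_divide_eq times_divide_eq_left if_True)
  ultimately obtain \<gamma> where "max (2 / 5) ((x + 1) / (2 * x + 4)) < \<gamma>" "\<gamma> < \<alpha>"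
    using dense[of "max (2 / 5) ((x + 1) / (2 * x + 4))" \<alpha>] by auto
  then show ?thesis
    using pos by (intro exI[of _ \<gamma>]) (auto simp: \<alpha>_def divide_less_eq mult.commute)
qed

lemma card_edges_le_square:
  assumes "simple_graph G"
  shows "card (edges G) \<le> (card (verts G))\<^sup>2"
proof -
  have "edges G \<subseteq> (\<lambda>(a, b). {a, b}) ` (verts G \<times> verts G)"
    using assms by (force simp: simple_graph_def card_2_iff)
  then have "card (edges G) \<le> card (verts G \<times> verts G)"
    using assms by (intro surj_card_le) (auto simp: simple_graph_def)
  then show ?thesis by (simp add: card_cartesian_product power2_eq_square)
qed

lemma ex_edge_bound_if_eventually:
  fixes P :: "'a graph \<Rightarrow> bool"
  assumes "0 \<le> \<alpha>" and eventually: "\<forall>\<^sub>F n in sequentially. \<forall>G. simple_graph G \<and> card (verts G) = n \<and> P G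
    \<longrightarrow> card (edges G) \<le> real n powr (1 + \<alpha>)"
  shows "\<exists>C. \<forall>n G. simple_graph G \<and> card (verts G) = n \<and> P G
    \<longrightarrow> card (edges G) \<le> C * real n powr (1 + \<alpha>)"
proof -
  obtain N where N: "\<And>n G. N \<le> n \<Longrightarrow> simple_graph G \<Longrightarrow> card (verts G) = n \<Longrightarrow> P G
      \<Longrightarrow> card (edges G) \<le> real n powr (1 + \<alpha>)"
    using eventually unfolding eventually_sequentially by blast
  have "card (edges G) \<le> (1 + (real N)\<^sup>2) * real n powr (1 + \<alpha>)"
    if G: "simple_graph G" "card (verts G) = n" "P G" for n G
  proof (cases "N \<le> n")
    case True
    then have "card (edges G) \<le> real n powr (1 + \<alpha>)" using N G by blast
    also have "\<dots> \<le> (1 + (real N)\<^sup>2) * real n powr (1 + \<alpha>)" by (simp add: distrib_right)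
    finally show ?thesis .
  next
    case False
    show ?thesis
    proof (cases "n = 0")
      case True
      then show ?thesis using card_edges_le_square[OF G(1)] G(2) by simp
    next
      case n: False
      have "card (edges G) \<le> n\<^sup>2"
        using card_edges_le_square[OF G(1)] G(2) by simp
      also have "\<dots> \<le> N\<^sup>2" using False by (intro power_mono) auto
      finally have "card (edges G) \<le> real (N\<^sup>2)" by (rule of_nat_mono)
      also have "\<dots> \<le> (1 + (real N)\<^sup>2) * 1" by simp
      also have "\<dots> \<le> (1 + (real N)\<^sup>2) * real n powr (1 + \<alpha>)"
        using n assms(1) by (intro mult_left_mono ge_one_powr_ge_zero) auto
      finally show ?thesis .
    qed
  qed
  then show ?thesis by blast
qed

lemma subdivision_K_plus_free_edges_le:
  assumes "1 \<le> s" "0 < t"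
  shows "\<exists>C::real. \<forall>(n::nat) (G::'a graph).
    simple_graph G \<and> card (verts G) = n \<and> \<not> contains_copy G (subdivision (K_plus s t))
    \<longrightarrow> card (edges G) \<le> C * real n powr (1 + (real s ^ 2 + 1) / (2 * real s + 2 * real s ^ 2))"
proof (rule ex_edge_bound_if_eventually)
  let ?\<alpha> = "(real s ^ 2 + 1) / (2 * real s + 2 * real s ^ 2)"
  obtain \<gamma> :: real where \<gamma>: "\<gamma> < ?\<alpha>" "2 < 5 * \<gamma>" "real s + 1 < (2 * s + 4) * \<gamma>"
    using ex_exponent[of "real s"] assms(1) by auto
  obtain M :: real where M: "\<And>(G::'a graph) n d. simple_graph G \<Longrightarrow> card (verts G) = n
      \<Longrightarrow> \<not> contains_copy G (subdivision (K_plus s t)) \<Longrightarrow> 0 < n \<Longrightarrow> 0 < d \<Longrightarrow> M \<le> d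
      \<Longrightarrow> 4 * real n * d * Suc (floor_log n) \<le> card (edges G)
      \<Longrightarrow> d ^ 5 \<le> M * n ^ 2 \<or> d ^ (2 * s + 4) \<le> M * n ^ (s + 1)"
    using subdivision_K_plus_free_dichotomy[OF assms] by blast
  have "\<forall>\<^sub>F n in sequentially. M * real n ^ 0 < (real n powr \<gamma>) ^ 1"
    "\<forall>\<^sub>F n in sequentially. M * real n ^ 2 < (real n powr \<gamma>) ^ 5"
    "\<forall>\<^sub>F n in sequentially. M * real n ^ (s + 1) < (real n powr \<gamma>) ^ (2 * s + 4)"
    using \<gamma> by (intro eventually_const_mult_power_less_powr; simp)+
  moreover have "\<forall>\<^sub>F n in sequentially. 4 * real (Suc (floor_log n)) \<le> real n powr (?\<alpha> - \<gamma>)"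
    using \<gamma>(1) by (intro eventually_floor_log_le_powr) simp
  ultimately show "\<forall>\<^sub>F n in sequentially. \<forall>G::'a graph. simple_graph G \<and> card (verts G) = n
      \<and> \<not> contains_copy G (subdivision (K_plus s t)) \<longrightarrow> card (edges G) \<le> real n powr (1 + ?\<alpha>)"
    using eventually_gt_at_top[of 0]
  proof eventually_elim
    case (elim n)
    have "4 * real n * real n powr \<gamma> * Suc (floor_log n)
        \<le> real n * real n powr \<gamma> * real n powr (?\<alpha> - \<gamma>)"
      using mult_left_mono[OF elim(4), of "real n * real n powr \<gamma>"]
      by (simp add: mult_ac del: of_nat_Suc)
    also have "\<dots> = real n powr (1 + ?\<alpha>)"
      using elim(5) by (simp add: powr_add powr_diff)
    finally show ?case
      using M[of _ n "real n powr \<gamma>"] elim by fastforce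
  qed
qed simp

lemma ex_le_if_edges_le:
  assumes "edges F \<noteq> {}"
    and "\<And>G :: nat graph. simple_graph G \<Longrightarrow> card (verts G) = n \<Longrightarrow> \<not> contains_copy G F
      \<Longrightarrow> real (card (edges G)) \<le> c"
  shows "real (ex n F) \<le> c"
proof -
  have "ex n F \<in> {card (edges G) | G :: nat graph.
      simple_graph G \<and> card (verts G) = n \<and> \<not> contains_copy G F}"
    unfolding ex_def by (rule Max_in[OF finite_ex_set ex_set_nonempty[OF assms(1)]])
  then show ?thesis using assms(2) by auto
qed

theorem theorem1p7:
  fixes s t :: nat
  assumes "3 \<le> s" and "s \<le> t - 1"
  shows "(\<lambda>n. real (ex n (subdivision (K_plus s t))))
           \<in> O(\<lambda>n. real n powr (1 + (real s ^ 2 + 1) / (2 * real s + 2 * real s ^ 2)))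
       \<and> (\<exists>C::real. \<forall>(n::nat) (G::'a graph).
             simple_graph G \<and> card (verts G) = n \<and> \<not> contains_copy G (subdivision (K_plus s t))
             \<longrightarrow> real (card (edges G))
                   \<le> C * real n powr (1 + (real s ^ 2 + 1) / (2 * real s + 2 * real s ^ 2)))"
proof
  let ?F = "subdivision (K_plus s t)"
  let ?bound = "\<lambda>n. real n powr (1 + (real s ^ 2 + 1) / (2 * real s + 2 * real s ^ 2))"
  have st: "1 \<le> s" "0 < t" using assms by auto
  obtain C where "\<And>n (G::nat graph). simple_graph G \<Longrightarrow> card (verts G) = n \<Longrightarrow> \<not> contains_copy G ?F
      \<Longrightarrow> real (card (edges G)) \<le> C * ?bound n"
    using subdivision_K_plus_free_edges_le[OF st, where 'a = nat] by blast
  then have "real (ex n ?F) \<le> C * ?bound n" for n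
    by (intro ex_le_if_edges_le edges_subdivision_K_plus)
  then show "(\<lambda>n. real (ex n ?F)) \<in> O(?bound)"
    by (intro bigoI[of _ C]) simp
  show "\<exists>C::real. \<forall>(n::nat) (G::'a graph). simple_graph G \<and> card (verts G) = n \<and> \<not> contains_copy G ?F
      \<longrightarrow> real (card (edges G)) \<le> C * ?bound n"
    by (rule subdivision_K_plus_free_edges_le[OF st])
qed

end
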